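(* Let $\mathcal{G}$ be a noncompact metric graph in the class $\mathbf{G}$ with finitely many edges, no pendant and exactly one half-line. Then there exists $\delta>0$ such that for every $p\in[6,6+\delta]$ there exists $\mu>0$, depending on $p$ and $\mathcal{G}$, for which problem \[ \begin{cases} u''+u^{p-1}=\lambda u & \text{on every edge of }\mathcal{G},\\ u\in H^1(\mathcal{G}),\ u>0 & \text{on }\mathcal{G},\\ \sum_{e\succ \mathrm{v}}\frac{du}{dx_e}(\mathrm{v})=0 & \text{for every vertex }\mathrm{v}, \end{cases} \] admits a positive solution $u\in H^1_\mu(\mathcal{G})$ (for some $\lambda\in\mathbb R$) with $E(u,\mathcal{G})<0$.
   Context: A metric graph $\mathcal{G}=(\mathbb{V},\mathbb{E})$ belongs to the class $\mathbf{G}$ if it is connected, has at most countably many edges, every vertex has finite degree, and $\inf_{e\in\mathbb{E}}|e|>0$. Noncompact means it has at least one half-line or infinitely many edges. A pendant is a bounded edge one of whose vertices has degree $1$. $H^1(\mathcal{G})$ is the space of continuous functions on $\mathcal{G}$, $H^1$ on each edge, with finite $H^1$ norm; $H^1_\mu(\mathcal{G})=\{v\in H^1(\mathcal{G}):\|v\|_{L^2}^2=\mu\}$; $E(u,\mathcal{G})=\frac12\|u'\|_{L^2(\mathcal G)}^2-\frac1p\|u\|_{L^p(\mathcal G)}^p$. The vertex condition is the Kirchhoff condition: sum over edges $e$ incident at $\mathrm v$ of the outgoing derivatives of $u$ at $\mathrm v$ equals zero.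
   Formalization: The graph is assumed to have at least one bounded edge: for the bare half-line, which meets all the stated conditions, the only positive solutions are half-solitons, whose energy (p-6)/(4p)∫u^p is nonnegative for p≥6, so the claim fails there. *)

theory Defs
  imports "HOL-Analysis.Analysis"
begin

text \<open>A noncompact metric graph with finitely many edges and exactly one half-line is encoded by
  a number nV of vertices (vertices are 0..nV-1), a list E of bounded edges (a, b, l), each an
  interval [0,l] whose point 0 is glued to vertex a and point l to vertex b (loops and multiple
  edges allowed), and a vertex v0 at which the unique half-line [0,oo) is attached (at its point 0).\<close>

definition mg_wf :: "nat \<Rightarrow> (nat \<times> nat \<times> real) list \<Rightarrow> nat \<Rightarrow> bool" where
  "mg_wf nV E v0 \<longleftrightarrow> v0 < nV \<and> (\<forall>(a,b,l)\<in>set E. a < nV \<and> b < nV \<and> 0 < l)"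

definition mg_adj :: "(nat \<times> nat \<times> real) list \<Rightarrow> (nat \<times> nat) set" where
  "mg_adj E = {(a,b). \<exists>l. (a,b,l) \<in> set E \<or> (b,a,l) \<in> set E}"

definition mg_connected :: "nat \<Rightarrow> (nat \<times> nat \<times> real) list \<Rightarrow> bool" where
  "mg_connected nV E \<longleftrightarrow> (\<forall>v<nV. \<forall>w<nV. (v,w) \<in> (mg_adj E)\<^sup>*)"

text \<open>Degree of a vertex: a loop counts twice, the half-line counts once at v0.\<close>
definition mg_deg :: "(nat \<times> nat \<times> real) list \<Rightarrow> nat \<Rightarrow> nat \<Rightarrow> nat" where
  "mg_deg E v0 v = length (filter (\<lambda>(a,b,l). a = v) E) + length (filter (\<lambda>(a,b,l). b = v) E)
     + (if v = v0 then 1 else 0)"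

text \<open>No pendant: no bounded edge has an endpoint of degree 1.\<close>
definition mg_no_pendant :: "(nat \<times> nat \<times> real) list \<Rightarrow> nat \<Rightarrow> bool" where
  "mg_no_pendant E v0 \<longleftrightarrow> (\<forall>(a,b,l)\<in>set E. mg_deg E v0 a \<noteq> 1 \<and> mg_deg E v0 b \<noteq> 1)"

definition elen :: "(nat \<times> nat \<times> real) list \<Rightarrow> nat \<Rightarrow> real" where
  "elen E i = snd (snd (E ! i))"
definition etail :: "(nat \<times> nat \<times> real) list \<Rightarrow> nat \<Rightarrow> nat" where
  "etail E i = fst (E ! i)"
definition ehead :: "(nat \<times> nat \<times> real) list \<Rightarrow> nat \<Rightarrow> nat" where
  "ehead E i = fst (snd (E ! i))"

text \<open>f is a (classical, C^2-up-to-the-boundary) solution on S of f'' + f^(p-1) = lam f, with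
  first derivative df (one-sided at endpoints).\<close>
definition ode_sol_on :: "real set \<Rightarrow> real \<Rightarrow> real \<Rightarrow> (real \<Rightarrow> real) \<Rightarrow> (real \<Rightarrow> real) \<Rightarrow> bool" where
  "ode_sol_on S p lam f df \<longleftrightarrow>
     (\<exists>ddf. \<forall>x\<in>S. (f has_real_derivative df x) (at x within S)
                \<and> (df has_real_derivative ddf x) (at x within S)
                \<and> ddf x + f x powr (p - 1) = lam * f x)"

text \<open>u i is the function on bounded edge i (on [0, elen E i]), uh the function on the half-line,
  du, duh their derivatives.  positive_solution says (u,uh) is a positive H^1 solution of the
  Kirchhoff problem with parameters p, lam.\<close>
definition positive_solution ::
  "nat \<Rightarrow> (nat \<times> nat \<times> real) list \<Rightarrow> nat \<Rightarrow> real \<Rightarrow> real \<Rightarrow>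
   (nat \<Rightarrow> real \<Rightarrow> real) \<Rightarrow> (nat \<Rightarrow> real \<Rightarrow> real) \<Rightarrow> (real \<Rightarrow> real) \<Rightarrow> (real \<Rightarrow> real) \<Rightarrow> bool" where
  "positive_solution nV E v0 p lam u du uh duh \<longleftrightarrow>
     (\<forall>i<length E. ode_sol_on {0..elen E i} p lam (u i) (du i))
   \<and> ode_sol_on {0..} p lam uh duh
   \<and> (\<forall>i<length E. \<forall>x\<in>{0..elen E i}. u i x > 0)
   \<and> (\<forall>x\<ge>0. uh x > 0)
   \<comment> \<open>continuity at the vertices\<close>
   \<and> (\<exists>phi::nat \<Rightarrow> real.
        (\<forall>i<length E. u i 0 = phi (etail E i) \<and> u i (elen E i) = phi (ehead E i))
        \<and> uh 0 = phi v0)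
   \<comment> \<open>H^1 on the half-line (bounded edges: automatic from C^1 on a compact interval)\<close>
   \<and> set_integrable lborel {0..} (\<lambda>x. (uh x)\<^sup>2)
   \<and> set_integrable lborel {0..} (\<lambda>x. (duh x)\<^sup>2)
   \<comment> \<open>Kirchhoff condition: sum of outgoing derivatives vanishes at every vertex\<close>
   \<and> (\<forall>v<nV. (\<Sum>i<length E. (if etail E i = v then du i 0 else 0)
                          + (if ehead E i = v then - du i (elen E i) else 0))
             + (if v = v0 then duh 0 else 0) = 0)"

definition mass :: "(nat \<times> nat \<times> real) list \<Rightarrow> (nat \<Rightarrow> real \<Rightarrow> real) \<Rightarrow> (real \<Rightarrow> real) \<Rightarrow> real" where
  "mass E u uh = (\<Sum>i<length E. LBINT x:{0..elen E i}. (u i x)\<^sup>2) + (LBINT x:{0..}. (uh x)\<^sup>2)"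

definition energy ::
  "(nat \<times> nat \<times> real) list \<Rightarrow> real \<Rightarrow> (nat \<Rightarrow> real \<Rightarrow> real) \<Rightarrow> (nat \<Rightarrow> real \<Rightarrow> real)
   \<Rightarrow> (real \<Rightarrow> real) \<Rightarrow> (real \<Rightarrow> real) \<Rightarrow> real" where
  "energy E p u du uh duh =
     1/2 * ((\<Sum>i<length E. LBINT x:{0..elen E i}. (du i x)\<^sup>2) + (LBINT x:{0..}. (duh x)\<^sup>2))
   - 1/p * ((\<Sum>i<length E. LBINT x:{0..elen E i}. \<bar>u i x\<bar> powr p) + (LBINT x:{0..}. \<bar>uh x\<bar> powr p))"

end

theory Submission
  imports Defs "Jordan_Normal_Form.Determinant" "HOL-Probability.Discrete_Topology"
begin

text \<open>
  For \<open>lam = \<epsilon>\<^sup>2\<close> small the compact core is tiny compared with the width of the soliton, and the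
  equation has a solution that is almost a half-soliton on the half-line and almost constant on
  the core: after rescaling, \<open>v = s + \<epsilon>\<^sup>2 G f(v)\<close> on the core, where \<open>f(v) = v\<^sup>p\<^sup>-\<^sup>1 - v\<close>, \<open>s = v(v0)\<close> and
  \<open>G\<close> is the Green operator with Dirichlet condition at \<open>v0\<close>. This is solved by contraction for
  every \<open>s\<close>, and \<open>s\<close> is then adjusted by the intermediate value theorem so that the flux at \<open>v0\<close>
  matches the soliton.

  At \<open>p = 6\<close> the energy is half the integral over the core of \<open>u'\<^sup>2/2 + u\<^sup>p/p - lam u\<^sup>2/2\<close>, which is
  constant on each edge and vanishes on the half-line. Its leading coefficient is a positive
  multiple of \<open>3 T - K\<^sup>3\<close>, where \<open>K\<close> is the total length and \<open>T\<close> the torsional rigidity of the core. By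
  Thomson's principle \<open>T\<close> is at most the cost of any flow of unit divergence into \<open>v0\<close>, and a flow
  along a spanning tree shows \<open>T < K\<^sup>3/3\<close> unless the core is an interval attached at its end, which
  the absence of pendants excludes. All estimates are uniform in \<open>p\<close> near 6, and the extra term
  \<open>(p - 6) \<integral>u\<^sup>p / (4 p)\<close> is small.
\<close>

section \<open>Torsional rigidity\<close>

text \<open>The sign of \<open>3 T - K^3\<close> comes from three terms of equal order. Let
  \<open>W\<close> be the torsion function of the core (\<open>- W'' = 1\<close>,
  \<open>W = 0\<close> at \<open>v0\<close>, Kirchhoff elsewhere), \<open>m\<close> the maximum of
  the soliton and \<open>f = f(m)\<close>. To leading order the rescaled solution is
  \<open>s + \<epsilon>^2 f W\<close>. After division by the common scale, the conserved quantity on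
  an edge receives \<open>f^2 W'^2 / 2\<close> from the slope, \<open>f^2 W\<close> from the change
  of potential away from \<open>s\<close>, and \<open>- f^2 K^2 / 2\<close> from the potential at
  \<open>s\<close>: the soliton has zero Hamiltonian, and its slope at the junction is the flux
  \<open>\<epsilon> f K\<close> leaving the core. As \<open>T\<close> is the integral of both
  \<open>W\<close> and \<open>W'^2\<close>, the core contributes \<open>f^2 (3 T - K^3) / 2\<close>.
  This gain is of relative order \<open>\<epsilon>^4\<close>, whereas the \<open>(p - 6)\<close>
  term carries no small factor besides \<open>p - 6\<close> in the bounds used. Hence
  \<open>\<epsilon>\<close> is fixed first, from constants valid for all \<open>p\<close> in
  \<open>[6, 7]\<close>, and only then is \<open>\<delta>\<close> chosen, of order
  \<open>\<epsilon>^4\<close>. The mass is not prescribed: \<open>\<mu>\<close> is read off from the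
  solution.\<close>

definition net_flux ::
  "(nat \<Rightarrow> nat) \<Rightarrow> (nat \<Rightarrow> nat) \<Rightarrow> nat set \<Rightarrow> (nat \<Rightarrow> real) \<Rightarrow> (nat \<Rightarrow> real) \<Rightarrow> nat \<Rightarrow> real" where
  "net_flux src tgt I p q v =
     (\<Sum>i\<in>I. (if src i = v then p i else 0) + (if tgt i = v then q i else 0))"

definition edge_rel :: "(nat \<Rightarrow> nat) \<Rightarrow> (nat \<Rightarrow> nat) \<Rightarrow> nat set \<Rightarrow> (nat \<times> nat) set" where
  "edge_rel src tgt I = {(a, b). \<exists>i\<in>I. src i = a \<and> tgt i = b \<or> src i = b \<and> tgt i = a}"

definition edge_deg :: "(nat \<Rightarrow> nat) \<Rightarrow> (nat \<Rightarrow> nat) \<Rightarrow> nat set \<Rightarrow> nat \<Rightarrow> nat" where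
  "edge_deg src tgt I v = card {i\<in>I. src i = v} + card {i\<in>I. tgt i = v}"

text \<open>Summation by parts on the graph. \<open>p i\<close> and \<open>q i\<close> play the role
  of outgoing derivatives at the two ends of an edge; they are independent, so
  \<open>p i + q i\<close> is the amount produced inside the edge.\<close>

lemma sum_potential_net_flux:
  assumes "finite I" "finite S" "src ` I \<subseteq> S" "tgt ` I \<subseteq> S"
  shows "(\<Sum>i\<in>I. W (src i) * p i + W (tgt i) * q i) = (\<Sum>v\<in>S. W v * net_flux src tgt I p q v)"
proof -
  have "(\<Sum>v\<in>S. W v * net_flux src tgt I p q v) =
     (\<Sum>i\<in>I. \<Sum>v\<in>S. (if src i = v then W v * p i else 0) + (if tgt i = v then W v * q i else 0))"
    unfolding net_flux_def sum_distrib_left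
    by (subst sum.swap) (intro sum.cong refl, auto simp: algebra_simps)
  also have "\<dots> = (\<Sum>i\<in>I. W (src i) * p i + W (tgt i) * q i)"
    using assms by (intro sum.cong refl) (auto simp: sum.distrib sum.delta)
  finally show ?thesis by simp
qed

lemma sum_potential_eq_0:
  assumes "finite I" "W r = 0" "\<And>v. v \<noteq> r \<Longrightarrow> net_flux src tgt I p q v = 0"
  shows "(\<Sum>i\<in>I. W (src i) * p i + W (tgt i) * q i) = 0"
proof -
  have "(\<Sum>i\<in>I. W (src i) * p i + W (tgt i) * q i)
      = (\<Sum>v\<in>src ` I \<union> tgt ` I. W v * net_flux src tgt I p q v)"
    using assms(1) by (intro sum_potential_net_flux) auto
  also have "\<dots> = 0"
    using assms(2,3) by (intro sum.neutral) (metis mult_zero_left mult_zero_right)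
  finally show ?thesis .
qed

lemma sum_net_flux:
  assumes "finite I" "finite S" "src ` I \<subseteq> S" "tgt ` I \<subseteq> S"
  shows "(\<Sum>v\<in>S. net_flux src tgt I p q v) = (\<Sum>i\<in>I. p i + q i)"
  using sum_potential_net_flux[OF assms, of "\<lambda>_. 1" p q] by simp

text \<open>Conservation: whatever the edges produce can leave only at the root. For unit divergence
  this is the total length.\<close>

lemma net_flux_root:
  assumes "finite I" "\<And>v. v \<noteq> r \<Longrightarrow> net_flux src tgt I p q v = 0"
  shows "net_flux src tgt I p q r = (\<Sum>i\<in>I. p i + q i)"
proof -
  let ?S = "insert r (src ` I \<union> tgt ` I)"
  have "(\<Sum>i\<in>I. p i + q i) = (\<Sum>v\<in>?S. net_flux src tgt I p q v)"
    using assms(1) by (intro sum_net_flux[symmetric]) auto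
  also have "\<dots> = net_flux src tgt I p q r"
  proof -
    have "(\<Sum>v\<in>?S. net_flux src tgt I p q v)
        = (\<Sum>v\<in>?S. if v = r then net_flux src tgt I p q v else 0)"
      using assms(2) by (intro sum.cong) auto
    then show ?thesis using assms(1) by (simp add: sum.delta)
  qed
  finally show ?thesis ..
qed

lemma net_flux_Un:
  assumes "finite A" "finite B" "A \<inter> B = {}"
  shows "net_flux src tgt (A \<union> B) p q v = net_flux src tgt A p q v + net_flux src tgt B p q v"
  unfolding net_flux_def by (rule sum.union_disjoint[OF assms])

lemma edge_relI1: "i \<in> I \<Longrightarrow> (src i, tgt i) \<in> edge_rel src tgt I"
  and edge_relI2: "i \<in> I \<Longrightarrow> (tgt i, src i) \<in> edge_rel src tgt I"
  by (auto simp: edge_rel_def)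

text \<open>A flow \<open>d\<close> with unit divergence has profile \<open>d i - x\<close> on edge \<open>i\<close>, so that
  \<open>(d i ^ 3 + (len i - d i) ^ 3) / 3\<close> is the integral of its square. The induction splits off an
  edge at the root; the subgraph behind it is rooted at its other end.\<close>
lemma unit_flow_cost_le:
  assumes "finite I" "\<And>i. i \<in> I \<Longrightarrow> 0 < len i"
    and "\<And>i. i \<in> I \<Longrightarrow> (r, src i) \<in> (edge_rel src tgt I)\<^sup>*"
  shows "\<exists>d. (\<forall>v. v \<noteq> r \<longrightarrow> net_flux src tgt I d (\<lambda>i. len i - d i) v = 0)
     \<and> (\<Sum>i\<in>I. d i ^ 3 + (len i - d i) ^ 3) \<le> (\<Sum>i\<in>I. len i) ^ 3
     \<and> (I \<noteq> {} \<and> (\<forall>v. v \<noteq> r \<longrightarrow> edge_deg src tgt I v \<noteq> 1)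
        \<longrightarrow> (\<Sum>i\<in>I. d i ^ 3 + (len i - d i) ^ 3) < (\<Sum>i\<in>I. len i) ^ 3)"
  using assms
proof (induction "card I" arbitrary: I r rule: less_induct)
  case less
  note fin = \<open>finite I\<close> and pos = less.prems(2) and reach = less.prems(3)
  show ?case
  proof (cases "I = {}")
    case True
    then show ?thesis by (auto simp: net_flux_def)
  next
    case False
    then obtain j where j: "j \<in> I" by blast
    have "\<exists>e\<in>I. src e = r \<or> tgt e = r"
    proof (cases "src j = r")
      case False
      with reach[OF j] obtain y where "(r, y) \<in> edge_rel src tgt I"
        by (metis converse_rtranclE)
      then show ?thesis by (auto simp: edge_rel_def)
    qed (use j in auto)
    then obtain e b where e: "e \<in> I" and eb: "src e = r \<and> tgt e = b \<or> src e = b \<and> tgt e = r"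
      by blast
    define I' where "I' = I - {e}"
    let ?R = "edge_rel src tgt I'"
    \<comment> \<open>\<open>A\<close> consists of the edges still attached to the root once
      \<open>e\<close> is removed, and \<open>B\<close> of those that hang on \<open>e\<close> and
      hence on its other end \<open>b\<close>. If \<open>e\<close> lies on a cycle, \<open>B\<close>
      is empty and the flow simply treats \<open>e\<close> as cut at \<open>b\<close>.\<close>
    define A where "A = {i\<in>I'. (r, src i) \<in> ?R\<^sup>*}"
    define B where "B = I' - A"
    have fA: "finite A" and fB: "finite B" using fin by (auto simp: A_def B_def I'_def)
    have I_eq: "I = insert e (A \<union> B)" and eA: "e \<notin> A \<union> B" and AB: "A \<inter> B = {}"
      using e by (auto simp: A_def B_def I'_def)
    have cA: "card A < card I" and cB: "card B < card I"
      using fin I_eq eA by (auto intro!: psubset_card_mono simp del: card_insert_disjoint)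
    have reach_ends: "(r, src i) \<in> ?R\<^sup>* \<longleftrightarrow> (r, tgt i) \<in> ?R\<^sup>*" if "i \<in> I'" for i
      using edge_relI1[OF that, of src tgt] edge_relI2[OF that, of tgt src]
      by (meson rtrancl.rtrancl_into_rtrancl)
    have reachA: "(r, v) \<in> (edge_rel src tgt A)\<^sup>*" if "(r, v) \<in> ?R\<^sup>*" for v
      using that
    proof induction
      case (step y z)
      from step(2) obtain i where i: "i \<in> I'" "src i = y \<and> tgt i = z \<or> src i = z \<and> tgt i = y"
        by (auto simp: edge_rel_def)
      with step(1) reach_ends have "i \<in> A" by (auto simp: A_def)
      with i have "(y, z) \<in> edge_rel src tgt A" by (auto simp: edge_rel_def)
      with step show ?case by (metis rtrancl.rtrancl_into_rtrancl)
    qed simp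
    have split: "(r, v) \<in> ?R\<^sup>* \<or> (b, v) \<in> ?R\<^sup>*" if "(r, v) \<in> (edge_rel src tgt I)\<^sup>*" for v
      using that
    proof induction
      case (step y z)
      from step(2) obtain i where i: "i \<in> I" "src i = y \<and> tgt i = z \<or> src i = z \<and> tgt i = y"
        by (auto simp: edge_rel_def)
      show ?case
      proof (cases "i = e")
        case False
        with i have "(y, z) \<in> ?R" by (auto simp: edge_rel_def I'_def)
        with step(3) show ?thesis by (meson rtrancl.rtrancl_into_rtrancl)
      qed (use i eb in auto)
    qed simp
    have reachB: "(r, v) \<in> ?R\<^sup>* \<or> (b, v) \<in> (edge_rel src tgt B)\<^sup>*" if "(b, v) \<in> ?R\<^sup>*" for v
      using that
    proof induction
      case (step y z)
      from step(2) obtain i where i: "i \<in> I'" "src i = y \<and> tgt i = z \<or> src i = z \<and> tgt i = y"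
        by (auto simp: edge_rel_def)
      show ?case
      proof (cases "i \<in> A")
        case True
        with i reach_ends[OF i(1)] show ?thesis by (auto simp: A_def)
      next
        case False
        with i have "(y, z) \<in> edge_rel src tgt B" by (auto simp: edge_rel_def B_def)
        with step(2,3) show ?thesis by (meson rtrancl.rtrancl_into_rtrancl)
      qed
    qed simp
    have B_root: "(b, src i) \<in> (edge_rel src tgt B)\<^sup>*" if "i \<in> B" for i
    proof -
      have "i \<in> I" "(r, src i) \<notin> ?R\<^sup>*" using that by (auto simp: B_def A_def I'_def)
      with split[OF reach] reachB show ?thesis by blast
    qed
    have loop: "B = {}" if "b = r"
      using split[OF reach] that by (auto simp: B_def A_def I'_def)
    obtain dA where dA: "\<And>v. v \<noteq> r \<Longrightarrow> net_flux src tgt A dA (\<lambda>i. len i - dA i) v = 0"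
      "(\<Sum>i\<in>A. dA i ^ 3 + (len i - dA i) ^ 3) \<le> (\<Sum>i\<in>A. len i) ^ 3"
    proof -
      have "0 < len i" if "i \<in> A" for i using pos that I_eq by blast
      moreover have "(r, src i) \<in> (edge_rel src tgt A)\<^sup>*" if "i \<in> A" for i
        using that by (intro reachA) (simp add: A_def)
      ultimately show thesis using less.hyps[OF cA fA, of r] that by blast
    qed
    obtain dB where dB: "\<And>v. v \<noteq> b \<Longrightarrow> net_flux src tgt B dB (\<lambda>i. len i - dB i) v = 0"
      "(\<Sum>i\<in>B. dB i ^ 3 + (len i - dB i) ^ 3) \<le> (\<Sum>i\<in>B. len i) ^ 3"
      and dB_less: "B \<noteq> {} \<and> (\<forall>v. v \<noteq> b \<longrightarrow> edge_deg src tgt B v \<noteq> 1)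
        \<longrightarrow> (\<Sum>i\<in>B. dB i ^ 3 + (len i - dB i) ^ 3) < (\<Sum>i\<in>B. len i) ^ 3"
    proof -
      have "0 < len i" if "i \<in> B" for i using pos that I_eq by blast
      then show thesis using less.hyps[OF cB fB, of b] B_root that by blast
    qed
    have posA: "0 < len i" if "i \<in> A" for i using pos that I_eq by blast
    have posB: "0 < len i" if "i \<in> B" for i using pos that I_eq by blast
    define a M where "a = (\<Sum>i\<in>A. len i)" and "M = (\<Sum>i\<in>B. len i)"
    have a0: "a \<ge> 0" "A \<noteq> {} \<Longrightarrow> a > 0" and M0: "M \<ge> 0"
      using posA posB fA by (auto simp: a_def M_def less_imp_le intro!: sum_nonneg sum_pos)
    have le: "len e > 0" using pos e by simp
    have len_sum: "(\<Sum>i\<in>I. len i) = len e + (a + M)"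
      unfolding a_def M_def using I_eq eA fA fB AB by (simp add: sum.union_disjoint)
    \<comment> \<open>Edge \<open>e\<close> carries the production \<open>M\<close> of
      \<open>B\<close> in at \<open>b\<close> and \<open>len e + M\<close> out at the root. The
      profile is \<open>d - x\<close> from the source end, so its initial value depends on which end
      of \<open>e\<close> is the root.\<close>
    define de where "de = (if src e = r then len e + M else - M)"
    define d where "d = (\<lambda>i. if i = e then de else if i \<in> A then dA i else dB i)"
    have flux_A: "net_flux src tgt A d (\<lambda>i. len i - d i) v = net_flux src tgt A dA (\<lambda>i. len i - dA i) v" for v
      unfolding net_flux_def d_def using eA by (intro sum.cong) auto
    have flux_B: "net_flux src tgt B d (\<lambda>i. len i - d i) v = net_flux src tgt B dB (\<lambda>i. len i - dB i) v" for v
      unfolding net_flux_def d_def using eA AB by (intro sum.cong) auto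
    have flux_b: "net_flux src tgt B dB (\<lambda>i. len i - dB i) b = M"
      using net_flux_root[OF fB, of b src tgt dB "\<lambda>i. len i - dB i"] dB(1) by (simp add: M_def)
    have flux_e: "net_flux src tgt {e} d (\<lambda>i. len i - d i) v
        = (if v = r then len e + M else 0) + (if v = b then - M else 0)" for v
      using eb loop by (auto simp: net_flux_def d_def de_def M_def)
    have flux: "net_flux src tgt I d (\<lambda>i. len i - d i) v = 0" if "v \<noteq> r" for v
    proof -
      have "net_flux src tgt I d (\<lambda>i. len i - d i) v
          = net_flux src tgt {e} d (\<lambda>i. len i - d i) v + (net_flux src tgt A d (\<lambda>i. len i - d i) v
            + net_flux src tgt B d (\<lambda>i. len i - d i) v)"
        using I_eq eA AB fA fB net_flux_Un[of "{e}" "A \<union> B"] net_flux_Un[of A B] by simp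
      also have "\<dots> = 0"
        using that dA(1)[OF that] dB(1)[of v] flux_b by (auto simp: flux_A flux_B flux_e)
      finally show ?thesis .
    qed
    have cost_A: "(\<Sum>i\<in>A. d i ^ 3 + (len i - d i) ^ 3) = (\<Sum>i\<in>A. dA i ^ 3 + (len i - dA i) ^ 3)"
      unfolding d_def using eA by (intro sum.cong) auto
    have cost_B: "(\<Sum>i\<in>B. d i ^ 3 + (len i - d i) ^ 3) = (\<Sum>i\<in>B. dB i ^ 3 + (len i - dB i) ^ 3)"
      unfolding d_def using eA AB by (intro sum.cong) auto
    have cost_e: "d e ^ 3 + (len e - d e) ^ 3 = (len e + M) ^ 3 - M ^ 3"
      by (simp add: d_def de_def power3_eq_cube algebra_simps)
    have cost: "(\<Sum>i\<in>I. d i ^ 3 + (len i - d i) ^ 3) = (len e + M) ^ 3 - M ^ 3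
        + ((\<Sum>i\<in>A. dA i ^ 3 + (len i - dA i) ^ 3) + (\<Sum>i\<in>B. dB i ^ 3 + (len i - dB i) ^ 3))"
      using I_eq eA AB fA fB
      by (simp add: sum.union_disjoint cost_A cost_B cost_e)
    \<comment> \<open>The cross term is the saving obtained when two branches meet at the root,
      instead of one long path.\<close>
    have cube: "(len e + (a + M)) ^ 3 = (len e + M) ^ 3 + a ^ 3 + 3 * (len e + M) * a * (len e + M + a)"
      by (simp add: power3_eq_cube algebra_simps)
    have le_cube: "(\<Sum>i\<in>I. d i ^ 3 + (len i - d i) ^ 3)
        \<le> (\<Sum>i\<in>I. len i) ^ 3 - 3 * (len e + M) * a * (len e + M + a)"
      using dA(2) dB(2) unfolding cost len_sum cube a_def[symmetric] M_def[symmetric] by linarith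
    have gap: "3 * (len e + M) * a * (len e + M + a) \<ge> 0"
      using a0 M0 le by (intro mult_nonneg_nonneg) auto
    show ?thesis
    proof (cases "A = {} \<and> b = r")
      \<comment> \<open>A single loop: the flow built above would cut it at the root and cost
        exactly \<open>len e ^ 3\<close>. Draining it symmetrically to both ends costs a quarter of
        that.\<close>
      case True
      then have I1: "I = {e}" using loop I_eq by simp
      have "src e = r" "tgt e = r" using True eb by auto
      then have "net_flux src tgt I (\<lambda>_. len e / 2) (\<lambda>i. len i - len e / 2) v = 0" if "v \<noteq> r" for v
        using that by (simp add: I1 net_flux_def)
      moreover have "(\<Sum>i\<in>I. (len e / 2) ^ 3 + (len i - len e / 2) ^ 3) < (\<Sum>i\<in>I. len i) ^ 3"
        using le by (simp add: I1 power3_eq_cube)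
      ultimately show ?thesis by (intro exI[of _ "\<lambda>_. len e / 2"]) auto
    next
      case notloop: False
      have "(\<Sum>i\<in>I. d i ^ 3 + (len i - d i) ^ 3) < (\<Sum>i\<in>I. len i) ^ 3"
        if deg: "\<forall>v. v \<noteq> r \<longrightarrow> edge_deg src tgt I v \<noteq> 1"
      proof (cases "A = {}")
        case False
        then have "3 * (len e + M) * a * (len e + M + a) > 0"
          using a0 M0 le by (intro mult_pos_pos) auto
        then show ?thesis using le_cube by linarith
      next
        \<comment> \<open>There is no saving at the root, so strictness must come from
          \<open>B\<close>. Its new root \<open>b\<close> is exempt from the degree condition, the
          old root has degree 0 in \<open>B\<close>, and all other degrees are unchanged.
          \<open>B\<close> is nonempty, as otherwise \<open>b\<close> would have degree 1.\<close>
        case True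
        with notloop have br: "b \<noteq> r" by simp
        have IB: "I = insert e B" "e \<notin> B" using I_eq eA True by auto
        have degI: "edge_deg src tgt I v = edge_deg src tgt B v + (if v = r \<or> v = b then 1 else 0)" for v
        proof -
          have t: "{i \<in> I. src i = v} = (if src e = v then insert e {i\<in>B. src i = v} else {i\<in>B. src i = v})"
            and h: "{i \<in> I. tgt i = v} = (if tgt e = v then insert e {i\<in>B. tgt i = v} else {i\<in>B. tgt i = v})"
            using IB by auto
          show ?thesis unfolding edge_deg_def t h using eb br fB IB(2) by auto
        qed
        have "B \<noteq> {}"
        proof
          assume "B = {}"
          then have "edge_deg src tgt I b = 1" by (simp add: degI) (simp add: edge_deg_def)
          with deg br show False by blast
        qed
        moreover have "edge_deg src tgt B v \<noteq> 1" if "v \<noteq> b" for v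
        proof (cases "v = r")
          case True
          have "src i \<noteq> r \<and> tgt i \<noteq> r" if "i \<in> B" for i
            using that reach_ends[of i] by (auto simp: B_def A_def)
          then have "{i\<in>B. src i = r} = {}" "{i\<in>B. tgt i = r} = {}" by auto
          then have "edge_deg src tgt B r = 0" by (simp only: edge_deg_def card.empty)
          then show ?thesis using True by simp
        qed (use degI deg that in auto)
        ultimately have "(\<Sum>i\<in>B. dB i ^ 3 + (len i - dB i) ^ 3) < M ^ 3"
          using dB_less by (simp add: M_def)
        then show ?thesis using dA(2) gap unfolding cost len_sum cube a_def[symmetric] by linarith
      qed
      then show ?thesis using flux le_cube gap by (intro exI[of _ d]) auto
    qed
  qed
qed

text \<open>Thomson's principle: among all flows of unit divergence the gradient flow of the torsion
  function \<open>W\<close> has the least cost.\<close>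
lemma torsion_le_flow_cost:
  assumes "finite I" "\<And>i. i \<in> I \<Longrightarrow> 0 < len i" "W r = 0"
    and W: "\<And>i. i \<in> I \<Longrightarrow> W (tgt i) = W (src i) + D i * len i - (len i)\<^sup>2 / 2"
    and D: "\<And>v. v \<noteq> r \<Longrightarrow> net_flux src tgt I D (\<lambda>i. len i - D i) v = 0"
    and d: "\<And>v. v \<noteq> r \<Longrightarrow> net_flux src tgt I d (\<lambda>i. len i - d i) v = 0"
  shows "(\<Sum>i\<in>I. len i * ((D i)\<^sup>2 / 2 + W (src i))) \<le> (\<Sum>i\<in>I. d i ^ 3 + (len i - d i) ^ 3) / 2"
proof -
  define z where "z = (\<lambda>i. d i - D i)"
  have z0: "net_flux src tgt I z (\<lambda>i. - z i) v = 0" if "v \<noteq> r" for v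
  proof -
    have "net_flux src tgt I z (\<lambda>i. - z i) v
        = net_flux src tgt I d (\<lambda>i. len i - d i) v - net_flux src tgt I D (\<lambda>i. len i - D i) v"
      unfolding net_flux_def sum_subtractf[symmetric] by (intro sum.cong) (auto simp: z_def)
    then show ?thesis using D d that by simp
  qed
  have "0 = (\<Sum>i\<in>I. W (src i) * z i + W (tgt i) * (- z i))"
    by (rule sum_potential_eq_0[symmetric, where r = r]) (use assms z0 in auto)
  also have "\<dots> = (\<Sum>i\<in>I. - z i * (D i * len i - (len i)\<^sup>2 / 2))"
    by (intro sum.cong refl) (simp add: W algebra_simps)
  finally have 1: "(\<Sum>i\<in>I. - z i * (D i * len i - (len i)\<^sup>2 / 2)) = 0" by simp
  \<comment> \<open>Integration by parts of \<open>W W'\<close>: the integrals of \<open>W\<close>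
    and of \<open>W'^2\<close> agree. The left side of the claim, the integral of
    \<open>W'^2 / 2 + W\<close>, is therefore three halves of the torsional rigidity.\<close>
  have 2: "(\<Sum>i\<in>I. W (src i) * D i + W (tgt i) * (len i - D i)) = 0"
    by (rule sum_potential_eq_0[where r = r]) (use assms in auto)
  \<comment> \<open>The integral of \<open>3 (D - x + z)^2\<close> expanded about the gradient flow.
    The term linear in \<open>z\<close> vanishes in the sum by the first identity, since
    \<open>z\<close> is divergence free and is tested against differences of \<open>W\<close>; the
    square remains.\<close>
  have eq: "d i ^ 3 + (len i - d i) ^ 3 = 2 * (len i * ((D i)\<^sup>2 / 2 + W (src i)))
     - 2 * (W (src i) * D i + W (tgt i) * (len i - D i))
     - 6 * (- z i * (D i * len i - (len i)\<^sup>2 / 2)) + 3 * len i * (z i)\<^sup>2" if "i \<in> I" for i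
    unfolding W[OF that] z_def by (simp add: power3_eq_cube power2_eq_square field_simps)
  have "(\<Sum>i\<in>I. d i ^ 3 + (len i - d i) ^ 3) = 2 * (\<Sum>i\<in>I. len i * ((D i)\<^sup>2 / 2 + W (src i)))
     - 2 * (\<Sum>i\<in>I. W (src i) * D i + W (tgt i) * (len i - D i))
     - 6 * (\<Sum>i\<in>I. - z i * (D i * len i - (len i)\<^sup>2 / 2)) + (\<Sum>i\<in>I. 3 * len i * (z i)\<^sup>2)"
    unfolding sum_distrib_left sum_subtractf[symmetric] sum.distrib[symmetric]
    by (intro sum.cong refl eq)
  moreover have "(\<Sum>i\<in>I. 3 * len i * (z i)\<^sup>2) \<ge> 0"
    using assms(2) by (intro sum_nonneg) (simp add: less_imp_le)
  ultimately show ?thesis using 1 2 by linarith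
qed

section \<open>Green operator of the core\<close>

text \<open>A trivial kernel makes the determinant nonzero, so the matrix is a unit. The formulation
  with index functions keeps matrices out of the graph argument.\<close>

lemma square_system_right_inverse:
  fixes A :: "nat \<Rightarrow> nat \<Rightarrow> real"
  assumes inj: "\<And>x. (\<And>i. i < n \<Longrightarrow> (\<Sum>j<n. A i j * x j) = 0) \<Longrightarrow> \<forall>j<n. x j = 0"
  obtains R where "\<And>i j. i < n \<Longrightarrow> j < n \<Longrightarrow> (\<Sum>k<n. A i k * R k j) = (if i = j then 1 else 0)"
proof -
  define M where "M = mat n n (\<lambda>(i,j). A i j)"
  have M: "M \<in> carrier_mat n n" by (simp add: M_def)
  have "det M \<noteq> 0"
  proof
    assume "det M = 0"
    then obtain v where v: "v \<in> carrier_vec n" "v \<noteq> 0\<^sub>v n" "M *\<^sub>v v = 0\<^sub>v n"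
      using det_0_iff_vec_prod_zero[OF M] by blast
    have "(\<Sum>j<n. A i j * vec_index v j) = 0" if "i < n" for i
    proof -
      have "vec_index (M *\<^sub>v v) i = 0" using v that by simp
      then show ?thesis using v(1) that
        by (simp add: M_def scalar_prod_def lessThan_atLeast0)
    qed
    from inj[OF this] have "v = 0\<^sub>v n" using v(1) by (intro eq_vecI) auto
    with v show False by simp
  qed
  then obtain B where B: "B \<in> carrier_mat n n" "M * B = 1\<^sub>m n"
    using det_non_zero_imp_unit[OF M] M by (auto simp: Units_def ring_mat_def)
  show thesis
  proof (rule that[of "\<lambda>i j. B $$ (i,j)"])
    fix i j assume ij: "i < n" "j < n"
    have "(M * B) $$ (i,j) = (if i = j then 1 else 0)" using B ij by simp
    then show "(\<Sum>k<n. A i k * B $$ (k,j)) = (if i = j then 1 else 0)"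
      using ij B(1) by (simp add: M_def scalar_prod_def lessThan_atLeast0)
  qed
qed

locale rooted_graph =
  fixes src tgt :: "nat \<Rightarrow> nat" and len :: "nat \<Rightarrow> real" and n nV r :: nat
  assumes root: "r < nV"
    and src_less: "i < n \<Longrightarrow> src i < nV"
    and tgt_less: "i < n \<Longrightarrow> tgt i < nV"
    and len_pos: "i < n \<Longrightarrow> 0 < len i"
    and reach: "v < nV \<Longrightarrow> (r, v) \<in> (edge_rel src tgt {..<n})\<^sup>*"
begin

abbreviation flux :: "(nat \<Rightarrow> real) \<Rightarrow> (nat \<Rightarrow> real) \<Rightarrow> nat \<Rightarrow> real" where
  "flux \<equiv> net_flux src tgt {..<n}"

lemma flux_outside: "nV \<le> v \<Longrightarrow> flux p q v = 0"
  unfolding net_flux_def by (intro sum.neutral) (auto dest: src_less tgt_less)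

text \<open>Kirchhoff sums of the function that is affine on every edge and takes the values
  \<open>y\<close> at the vertices.\<close>

definition laplacian :: "(nat \<Rightarrow> real) \<Rightarrow> nat \<Rightarrow> real" where
  "laplacian y = flux (\<lambda>i. (y (tgt i) - y (src i)) / len i) (\<lambda>i. (y (src i) - y (tgt i)) / len i)"

text \<open>Summation by parts turns the Dirichlet energy of \<open>y\<close> into boundary terms
  that all vanish, so \<open>y\<close> is constant along edges; every vertex is reachable from the
  root, where \<open>y\<close> is 0.\<close>

lemma laplacian_injective:
  assumes "y r = 0" "\<And>v. v < nV \<Longrightarrow> v \<noteq> r \<Longrightarrow> laplacian y v = 0" "v < nV"
  shows "y v = 0"
proof -
  have "(\<Sum>i<n. (y (tgt i) - y (src i))\<^sup>2 / len i)
      = - (\<Sum>i<n. y (src i) * ((y (tgt i) - y (src i)) / len i)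
                + y (tgt i) * ((y (src i) - y (tgt i)) / len i))"
    unfolding sum_negf[symmetric]
    by (intro sum.cong refl) (simp add: power2_eq_square algebra_simps diff_divide_distrib add_divide_distrib)
  also have "\<dots> = 0"
    using assms(1,2) flux_outside
    by (subst sum_potential_eq_0[where r = r]) (auto simp: laplacian_def, meson not_le)
  finally have "\<forall>i\<in>{..<n}. (y (tgt i) - y (src i))\<^sup>2 / len i = 0"
    by (subst (asm) sum_nonneg_eq_0_iff) (auto simp: len_pos less_imp_le)
  then have edge: "y (tgt i) = y (src i)" if "i < n" for i
    using len_pos[OF that] that by fastforce
  have "y v = y r" if "(r, v) \<in> (edge_rel src tgt {..<n})\<^sup>*" for v
    using that by induction (auto simp: edge_rel_def edge)
  then show ?thesis using reach[OF assms(3)] assms(1) by simp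
qed

lemma laplacian_matrix:
  "laplacian y v = (\<Sum>w<nV. laplacian (\<lambda>u. if u = w then 1 else 0) v * y w)"
proof -
  have delta: "y u = (\<Sum>w<nV. (if u = w then 1 else 0) * y w)" if "u < nV" for u
    using that by (simp add: if_distrib[of "\<lambda>c. c * _"] cong: if_cong)
  have e: "(y a - y b) / l
      = (\<Sum>w<nV. ((if a = w then 1 else 0) - (if b = w then 1 else 0)) / l * y w)"
    if "a < nV" "b < nV" for a b l
  proof -
    have "(y a - y b) / l = (\<Sum>w<nV. (if a = w then 1 else 0) * y w / l - (if b = w then 1 else 0) * y w / l)"
      unfolding sum_subtractf sum_divide_distrib[symmetric]
      using delta[OF that(1)] delta[OF that(2)] by (simp add: diff_divide_distrib)
    also have "\<dots> = (\<Sum>w<nV. ((if a = w then 1 else 0) - (if b = w then 1 else 0)) / l * y w)"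
      by (intro sum.cong refl) (simp add: field_simps)
    finally show ?thesis .
  qed
  show ?thesis
    unfolding laplacian_def net_flux_def sum_distrib_right
    apply (subst sum.swap)
    apply (intro sum.cong refl)
    subgoal for i
      using e[OF tgt_less src_less, of i i "len i"] e[OF src_less tgt_less, of i i "len i"]
      by (cases "src i = v"; cases "tgt i = v") (simp_all add: distrib_right sum.distrib)
    done
qed

text \<open>The equation at the root is replaced by \<open>y r = 0\<close>, which makes the square
  system injective. One matrix \<open>R\<close> serves all right-hand sides \<open>b\<close>;
  linearity and Lipschitz bounds in \<open>b\<close> are then immediate.\<close>

lemma laplacian_solve:
  obtains R :: "nat \<Rightarrow> nat \<Rightarrow> real" where
    "\<And>b. (\<Sum>w<nV. R r w * (if w = r then 0 else b w)) = 0"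
    "\<And>b v. v < nV \<Longrightarrow> v \<noteq> r \<Longrightarrow> laplacian (\<lambda>v. \<Sum>w<nV. R v w * (if w = r then 0 else b w)) v = b v"
proof -
  define A where "A = (\<lambda>v w. if v = r then (if w = r then 1 else 0)
    else laplacian (\<lambda>u. if u = w then 1 else 0) v)"
  have Ar: "(\<Sum>w<nV. A r w * x w) = x r" for x
    using root by (simp add: A_def if_distrib[of "\<lambda>c. c * _"] cong: if_cong)
  have Av: "(\<Sum>w<nV. A v w * x w) = laplacian x v" if "v \<noteq> r" for v x
    using that laplacian_matrix[of x v] by (simp add: A_def)
  have "\<forall>j<nV. x j = 0" if "\<And>i. i < nV \<Longrightarrow> (\<Sum>j<nV. A i j * x j) = 0" for x
    using laplacian_injective[of x] that Ar Av root by metis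
  then obtain R where R: "\<And>i j. i < nV \<Longrightarrow> j < nV \<Longrightarrow> (\<Sum>k<nV. A i k * R k j) = (if i = j then 1 else 0)"
    using square_system_right_inverse[of nV A] by blast
  have sol: "(\<Sum>k<nV. A v k * (\<Sum>w<nV. R k w * c w)) = c v" if "v < nV" for v c
  proof -
    have "(\<Sum>k<nV. A v k * (\<Sum>w<nV. R k w * c w)) = (\<Sum>w<nV. (\<Sum>k<nV. A v k * R k w) * c w)"
      unfolding sum_distrib_left sum_distrib_right
      by (subst sum.swap) (simp add: mult.assoc)
    also have "\<dots> = c v" using R that by (simp add: if_distrib[of "\<lambda>c. c * _"] cong: if_cong)
    finally show ?thesis .
  qed
  show thesis
  proof (rule that[of R])
    show "(\<Sum>w<nV. R r w * (if w = r then 0 else b w)) = 0" for b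
      using sol[OF root, of "\<lambda>w. if w = r then 0 else b w"] Ar by simp
    show "laplacian (\<lambda>v. \<Sum>w<nV. R v w * (if w = r then 0 else b w)) v = b v"
      if "v < nV" "v \<noteq> r" for b v
      using sol[OF that(1), of "\<lambda>w. if w = r then 0 else b w"] Av[OF that(2)] that by simp
  qed
qed

text \<open>First of two iterated primitives vanishing at 0: \<open>- src2 g i\<close> is the
  particular solution of \<open>- w'' = g i\<close> with zero value and slope at the source
  end.\<close>

definition src1 :: "(nat \<Rightarrow> real \<Rightarrow> real) \<Rightarrow> nat \<Rightarrow> real \<Rightarrow> real" where
  "src1 g i x = integral {0..x} (g i)"

definition src2 :: "(nat \<Rightarrow> real \<Rightarrow> real) \<Rightarrow> nat \<Rightarrow> real \<Rightarrow> real" where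
  "src2 g i x = integral {0..x} (src1 g i)"

definition edge_cont :: "(nat \<Rightarrow> real \<Rightarrow> real) \<Rightarrow> bool" where
  "edge_cont g \<longleftrightarrow> (\<forall>i<n. continuous_on {0..len i} (g i))"

lemma src1_deriv:
  assumes "edge_cont g" "i < n" "x \<in> {0..len i}"
  shows "(src1 g i has_real_derivative g i x) (at x within {0..len i})"
  using assms unfolding src1_def edge_cont_def
  by (intro integral_has_real_derivative) auto

lemma src1_cont: "edge_cont g \<Longrightarrow> edge_cont (src1 g)"
  unfolding edge_cont_def[of "src1 g"]
  by (meson DERIV_continuous_on src1_deriv)

lemma src2_deriv:
  assumes "edge_cont g" "i < n" "x \<in> {0..len i}"
  shows "(src2 g i has_real_derivative src1 g i x) (at x within {0..len i})"
  using src1_deriv[OF src1_cont[OF assms(1)] assms(2,3)] unfolding src1_def src2_def .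

lemma integral_diff_bound:
  assumes "continuous_on {0..l} g" "continuous_on {0..l} h" "x \<in> {0..l}"
    and "\<And>t. t \<in> {0..l} \<Longrightarrow> \<bar>g t - h t\<bar> \<le> (\<beta>::real)"
  shows "\<bar>integral {0..x} g - integral {0..x} h\<bar> \<le> \<beta> * l"
proof -
  have ig: "g integrable_on {0..x}" "h integrable_on {0..x}"
    using assms by (auto intro!: integrable_continuous_real elim!: continuous_on_subset)
  have "0 \<le> \<beta>" using assms(4)[OF assms(3)] by linarith
  have "norm (integral {0..x} (\<lambda>t. g t - h t)) \<le> \<beta> * (x - 0)"
    by (rule integral_bound) (use assms in \<open>auto intro!: continuous_intros elim!: continuous_on_subset\<close>)
  also have "\<dots> \<le> \<beta> * l" using \<open>0 \<le> \<beta>\<close> assms(3) by (intro mult_left_mono) auto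
  finally show ?thesis using ig by (simp add: integral_diff)
qed

lemma src1_diff_bound:
  assumes "edge_cont g" "edge_cont h" "i < n" "x \<in> {0..len i}"
    and "\<And>t. t \<in> {0..len i} \<Longrightarrow> \<bar>g i t - h i t\<bar> \<le> \<beta>"
  shows "\<bar>src1 g i x - src1 h i x\<bar> \<le> \<beta> * len i"
  using assms unfolding src1_def by (intro integral_diff_bound) (auto simp: edge_cont_def)

lemma src2_diff_bound:
  assumes "edge_cont g" "edge_cont h" "i < n" "x \<in> {0..len i}"
    and "\<And>t. t \<in> {0..len i} \<Longrightarrow> \<bar>g i t - h i t\<bar> \<le> \<beta>"
  shows "\<bar>src2 g i x - src2 h i x\<bar> \<le> \<beta> * len i * len i"
  using assms src1_cont src1_diff_bound[OF assms(1-3) _ assms(5)] unfolding src2_def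
  by (intro integral_diff_bound) (auto simp: edge_cont_def)

end

text \<open>\<open>Y g\<close> and \<open>D g\<close> are the vertex values and initial slopes of the solution of \<open>- w'' = g\<close>
  vanishing at the root and satisfying Kirchhoff's condition elsewhere.\<close>
locale green_graph = rooted_graph +
  fixes Y D :: "(nat \<Rightarrow> real \<Rightarrow> real) \<Rightarrow> nat \<Rightarrow> real" and C :: real
  assumes C_pos: "0 < C"
    and Y_root: "Y g r = 0"
    and Y_const: "Y (\<lambda>_ _. c) v = c * Y (\<lambda>_ _. 1) v"
    and Y_tgt: "i < n \<Longrightarrow> Y g (tgt i) = Y g (src i) + D g i * len i - src2 g i (len i)"
    and flux_D: "v \<noteq> r \<Longrightarrow> flux (D g) (\<lambda>i. src1 g i (len i) - D g i) v = 0"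
    and Y_diff: "\<lbrakk>edge_cont g; edge_cont h; \<And>i t. \<lbrakk>i < n; t \<in> {0..len i}\<rbrakk> \<Longrightarrow> \<bar>g i t - h i t\<bar> \<le> \<beta>; 0 \<le> \<beta>; v < nV\<rbrakk>
       \<Longrightarrow> \<bar>Y g v - Y h v\<bar> \<le> C * \<beta>"
    and D_diff: "\<lbrakk>edge_cont g; edge_cont h; \<And>i t. \<lbrakk>i < n; t \<in> {0..len i}\<rbrakk> \<Longrightarrow> \<bar>g i t - h i t\<bar> \<le> \<beta>; 0 \<le> \<beta>; i < n\<rbrakk>
       \<Longrightarrow> \<bar>D g i - D h i\<bar> \<le> C * \<beta>"
    and green_diff: "\<lbrakk>edge_cont g; edge_cont h; \<And>i t. \<lbrakk>i < n; t \<in> {0..len i}\<rbrakk> \<Longrightarrow> \<bar>g i t - h i t\<bar> \<le> \<beta>; 0 \<le> \<beta>; i < n; x \<in> {0..len i}\<rbrakk>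
       \<Longrightarrow> \<bar>(Y g (src i) + D g i * x - src2 g i x) - (Y h (src i) + D h i * x - src2 h i x)\<bar> \<le> C * \<beta>"

text \<open>On each edge the solution is the one with zero end values plus an affine function. Only
  the vertex values are unknown, and Kirchhoff's condition is a \<open>laplacian\<close> system for
  them.\<close>

lemma (in rooted_graph) green_graph_exists:
  obtains Y D C where "green_graph src tgt len n nV r Y D C"
proof -
  obtain R where R0: "\<And>b. (\<Sum>w<nV. R r w * (if w = r then 0 else b w)) = 0"
    and R1: "\<And>b v. v < nV \<Longrightarrow> v \<noteq> r \<Longrightarrow> laplacian (\<lambda>v. \<Sum>w<nV. R v w * (if w = r then 0 else b w)) v = b v"
    using laplacian_solve by blast
  \<comment> \<open>Kirchhoff sums of the solution of \<open>- w'' = g\<close> that vanishes at both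
    ends of each edge, namely \<open>x * src2 g i (len i) / len i - src2 g i x\<close>. The affine
    part has to compensate them, hence the sign in \<open>Y\<close>.\<close>
  define b where "b = (\<lambda>g. flux (\<lambda>i. src2 g i (len i) / len i) (\<lambda>i. src1 g i (len i) - src2 g i (len i) / len i))"
  define Y where "Y = (\<lambda>g v. \<Sum>w<nV. R v w * (if w = r then 0 else - b g w))"
  define D where "D = (\<lambda>g i. (Y g (tgt i) - Y g (src i) + src2 g i (len i)) / len i)"
  define \<Lambda> where "\<Lambda> = (\<Sum>i<n. len i)"
  define C0 where "C0 = (\<Sum>v<nV. \<Sum>w<nV. \<bar>R v w\<bar>) * (4 * \<Lambda>)"
  define C1 where "C1 = (\<Sum>i<n. 2 * C0 / len i + len i)"
  define C where "C = 1 + C0 + C1 + C1 * \<Lambda> + \<Lambda> * \<Lambda>"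
  have \<Lambda>0: "\<Lambda> \<ge> 0" unfolding \<Lambda>_def using len_pos by (intro sum_nonneg) (auto simp: less_imp_le)
  have len_le: "len i \<le> \<Lambda>" if "i < n" for i
    unfolding \<Lambda>_def using len_pos that by (intro member_le_sum) (auto simp: less_imp_le)
  have C00: "C0 \<ge> 0" unfolding C0_def using \<Lambda>0 by (intro mult_nonneg_nonneg sum_nonneg) auto
  have C10: "C1 \<ge> 0" unfolding C1_def using C00 len_pos
    by (intro sum_nonneg) (auto intro!: add_nonneg_nonneg divide_nonneg_nonneg simp: less_imp_le)
  have C1_ge: "2 * C0 / len i + len i \<le> C1" if "i < n" for i
    unfolding C1_def using that len_pos C00
    by (intro member_le_sum[where f = "\<lambda>i. 2 * C0 / len i + len i"])
      (auto intro!: add_nonneg_nonneg divide_nonneg_nonneg simp: less_imp_le)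
  have Yb: "\<bar>Y g v - Y h v\<bar> \<le> C0 * \<beta>"
    if g: "edge_cont g" "edge_cont h" "\<And>i t. \<lbrakk>i < n; t \<in> {0..len i}\<rbrakk> \<Longrightarrow> \<bar>g i t - h i t\<bar> \<le> \<beta>" "0 \<le> \<beta>" "v < nV"
    for g h \<beta> v
  proof -
    have b_bound: "\<bar>b g w - b h w\<bar> \<le> 4 * \<Lambda> * \<beta>" for w
    proof -
      have "\<bar>b g w - b h w\<bar> \<le> (\<Sum>i<n. 4 * len i * \<beta>)"
        unfolding b_def net_flux_def sum_subtractf[symmetric]
      proof (intro order_trans[OF sum_abs] sum_mono)
        fix i assume "i \<in> {..<n}"
        then have i: "i < n" and l: "len i \<in> {0..len i}" "len i > 0" using len_pos[of i] by auto
        have 1: "\<bar>src1 g i (len i) - src1 h i (len i)\<bar> \<le> \<beta> * len i"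
          using src1_diff_bound[OF g(1,2) i l(1) g(3)[OF i]] .
        have "\<bar>src2 g i (len i) / len i - src2 h i (len i) / len i\<bar>
            = \<bar>src2 g i (len i) - src2 h i (len i)\<bar> / len i"
          using l(2) by (simp add: diff_divide_distrib[symmetric])
        also have "\<dots> \<le> \<beta> * len i"
          using src2_diff_bound[OF g(1,2) i l(1) g(3)[OF i]] l(2) by (simp add: divide_le_eq mult.assoc)
        finally have 2: "\<bar>src2 g i (len i) / len i - src2 h i (len i) / len i\<bar> \<le> \<beta> * len i" .
        have "0 \<le> \<beta> * len i" using g(4) l(2) by simp
        then show "\<bar>(if src i = w then src2 g i (len i) / len i else 0)
            + (if tgt i = w then src1 g i (len i) - src2 g i (len i) / len i else 0)
            - ((if src i = w then src2 h i (len i) / len i else 0)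
            + (if tgt i = w then src1 h i (len i) - src2 h i (len i) / len i else 0))\<bar> \<le> 4 * len i * \<beta>"
          using 1 2 by (auto simp: abs_le_iff mult.commute)
      qed
      then show ?thesis by (simp add: \<Lambda>_def sum_distrib_left sum_distrib_right)
    qed
    have "\<bar>Y g v - Y h v\<bar> \<le> (\<Sum>w<nV. \<bar>R v w\<bar> * (4 * \<Lambda> * \<beta>))"
      unfolding Y_def sum_subtractf[symmetric]
    proof (intro order_trans[OF sum_abs] sum_mono)
      fix w
      have "\<bar>R v w * (if w = r then 0 else - b g w) - R v w * (if w = r then 0 else - b h w)\<bar>
          = \<bar>R v w\<bar> * (if w = r then 0 else \<bar>b g w - b h w\<bar>)"
        by (simp add: abs_minus_commute abs_mult flip: right_diff_distrib)
      also have "\<dots> \<le> \<bar>R v w\<bar> * (4 * \<Lambda> * \<beta>)"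
        using b_bound[of w] \<Lambda>0 g(4) by (intro mult_left_mono) auto
      finally show "\<bar>R v w * (if w = r then 0 else - b g w) - R v w * (if w = r then 0 else - b h w)\<bar>
          \<le> \<bar>R v w\<bar> * (4 * \<Lambda> * \<beta>)" .
    qed
    also have "\<dots> = (\<Sum>w<nV. \<bar>R v w\<bar>) * (4 * \<Lambda> * \<beta>)" by (simp add: sum_distrib_right)
    also have "\<dots> \<le> (\<Sum>v<nV. \<Sum>w<nV. \<bar>R v w\<bar>) * (4 * \<Lambda> * \<beta>)"
      using g(4,5) \<Lambda>0
      by (intro mult_right_mono member_le_sum[where f = "\<lambda>v. \<Sum>w<nV. \<bar>R v w\<bar>"]) (auto intro!: sum_nonneg)
    finally show ?thesis by (simp add: C0_def mult.assoc)
  qed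
  have Db: "\<bar>D g i - D h i\<bar> \<le> C1 * \<beta>"
    if g: "edge_cont g" "edge_cont h" "\<And>i t. \<lbrakk>i < n; t \<in> {0..len i}\<rbrakk> \<Longrightarrow> \<bar>g i t - h i t\<bar> \<le> \<beta>" "0 \<le> \<beta>" and i: "i < n"
    for g h \<beta> i
  proof -
    have l: "len i \<in> {0..len i}" "len i > 0" using len_pos[OF i] by auto
    have "\<bar>D g i - D h i\<bar> = \<bar>(Y g (tgt i) - Y h (tgt i)) - (Y g (src i) - Y h (src i))
        + (src2 g i (len i) - src2 h i (len i))\<bar> / len i"
      using l(2) unfolding D_def by (simp add: diff_divide_distrib[symmetric] algebra_simps)
    also have "\<dots> \<le> (C0 * \<beta> + C0 * \<beta> + \<beta> * len i * len i) / len i"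
      using Yb[OF g src_less[OF i]] Yb[OF g tgt_less[OF i]] src2_diff_bound[OF g(1,2) i l(1) g(3)[OF i]] l(2)
      by (intro divide_right_mono) (auto simp: abs_le_iff)
    also have "\<dots> = (2 * C0 / len i + len i) * \<beta>" using l(2) by (simp add: field_simps)
    also have "\<dots> \<le> C1 * \<beta>" using C1_ge[OF i] g(4) by (rule mult_right_mono)
    finally show ?thesis .
  qed
  have C_ge: "C0 \<le> C" "C1 \<le> C" "0 < C"
    using C00 C10 \<Lambda>0 by (auto simp: C_def intro!: add_pos_nonneg mult_nonneg_nonneg)
  show thesis
  proof (rule that[of Y D C], unfold_locales)
    show "0 < C" by fact
    show "Y g r = 0" for g unfolding Y_def by (rule R0)
    show "Y (\<lambda>_ _. c) v = c * Y (\<lambda>_ _. 1) v" for c v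
    proof -
      have s1: "src1 (\<lambda>_ _. c) i x = c * src1 (\<lambda>_ _. 1) i x" for i x
        unfolding src1_def using integral_mult_right[of "{0..x}" c "\<lambda>_. 1"] by simp
      then have "src1 (\<lambda>_ _. c) i = (\<lambda>x. c * src1 (\<lambda>_ _. 1) i x)" for i by blast
      then have s2: "src2 (\<lambda>_ _. c) i x = c * src2 (\<lambda>_ _. 1) i x" for i x
        unfolding src2_def by simp
      have "b (\<lambda>_ _. c) w = c * b (\<lambda>_ _. 1) w" for w
        unfolding b_def net_flux_def s1 s2 sum_distrib_left
        by (intro sum.cong) (auto simp: algebra_simps)
      then show ?thesis unfolding Y_def sum_distrib_left by (intro sum.cong) auto
    qed
    show "Y g (tgt i) = Y g (src i) + D g i * len i - src2 g i (len i)" if "i < n" for g i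
      using len_pos[OF that] by (simp add: D_def)
    show "flux (D g) (\<lambda>i. src1 g i (len i) - D g i) v = 0" if "v \<noteq> r" for g v
    proof (cases "v < nV")
      case True
      have "flux (D g) (\<lambda>i. src1 g i (len i) - D g i) v = laplacian (Y g) v + b g v"
        unfolding laplacian_def b_def net_flux_def sum.distrib[symmetric]
        by (intro sum.cong refl) (auto simp: D_def diff_divide_distrib add_divide_distrib)
      then show ?thesis using R1[OF True that, of "\<lambda>w. - b g w"] unfolding Y_def by simp
    qed (use flux_outside in auto)
    show "\<bar>Y g v - Y h v\<bar> \<le> C * \<beta>"
      if g: "edge_cont g" "edge_cont h" "\<And>i t. \<lbrakk>i < n; t \<in> {0..len i}\<rbrakk> \<Longrightarrow> \<bar>g i t - h i t\<bar> \<le> \<beta>" "0 \<le> \<beta>" "v < nV"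
      for g h \<beta> v
      using Yb[OF g] mult_right_mono[OF C_ge(1) g(4)] by linarith
    show "\<bar>D g i - D h i\<bar> \<le> C * \<beta>"
      if g: "edge_cont g" "edge_cont h" "\<And>i t. \<lbrakk>i < n; t \<in> {0..len i}\<rbrakk> \<Longrightarrow> \<bar>g i t - h i t\<bar> \<le> \<beta>" "0 \<le> \<beta>" "i < n"
      for g h \<beta> i
      using Db[OF g] mult_right_mono[OF C_ge(2) g(4)] by linarith
    show "\<bar>(Y g (src i) + D g i * x - src2 g i x) - (Y h (src i) + D h i * x - src2 h i x)\<bar> \<le> C * \<beta>"
      if g: "edge_cont g" "edge_cont h" "\<And>i t. \<lbrakk>i < n; t \<in> {0..len i}\<rbrakk> \<Longrightarrow> \<bar>g i t - h i t\<bar> \<le> \<beta>" "0 \<le> \<beta>" "i < n"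
        and x: "x \<in> {0..len i}"
      for g h \<beta> i x
    proof -
      have "\<bar>D g i * x - D h i * x\<bar> = \<bar>D g i - D h i\<bar> * x"
        using x by (simp add: left_diff_distrib[symmetric] abs_mult)
      also have "\<dots> \<le> C1 * \<beta> * \<Lambda>"
        using Db[OF g] x len_le[OF g(5)] C10 g(4) by (intro mult_mono) auto
      finally have 1: "\<bar>D g i * x - D h i * x\<bar> \<le> C1 * \<Lambda> * \<beta>" by (simp add: ac_simps)
      have "\<bar>src2 g i x - src2 h i x\<bar> \<le> \<beta> * len i * len i"
        using src2_diff_bound[OF g(1,2,5) x g(3)[OF g(5)]] .
      also have "\<dots> \<le> \<beta> * \<Lambda> * \<Lambda>"
        using len_le[OF g(5)] len_pos[OF g(5)] g(4) \<Lambda>0 by (intro mult_mono) auto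
      finally have 2: "\<bar>src2 g i x - src2 h i x\<bar> \<le> \<Lambda> * \<Lambda> * \<beta>" by (simp add: ac_simps)
      have "C * \<beta> = \<beta> + C0 * \<beta> + C1 * \<beta> + C1 * \<Lambda> * \<beta> + \<Lambda> * \<Lambda> * \<beta>"
        by (simp add: C_def algebra_simps)
      moreover have "C1 * \<beta> \<ge> 0" using C10 g(4) by simp
      ultimately show ?thesis using 1 2 Yb[OF g(1-4) src_less[OF g(5)]] g(4) by (simp add: abs_le_iff)
    qed
  qed
qed

section \<open>Semilinear Dirichlet problem\<close>

text \<open>Singletons of the discrete factor are open, so the product is a union of open slices.
  This models continuous functions on the disjoint union of the edges.\<close>

lemma continuous_on_discrete_prod:
  fixes F :: "'c discrete \<times> 'a::topological_space \<Rightarrow> 'b::topological_space"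
  assumes "\<And>i. continuous_on UNIV (\<lambda>x. F (i, x))"
  shows "continuous_on UNIV F"
proof -
  have "continuous_on (\<Union>i\<in>UNIV. {i} \<times> UNIV) F"
  proof (rule continuous_on_open_UN)
    fix i :: "'c discrete"
    show "open ({i} \<times> (UNIV :: 'a set))" by (intro open_Times open_discrete open_UNIV)
    have "continuous_on ({i} \<times> UNIV) (\<lambda>z. F (i, snd z))"
      by (rule continuous_on_compose2[OF assms]) (auto intro: continuous_intros)
    then show "continuous_on ({i} \<times> UNIV) F" by (rule continuous_on_eq) auto
  qed
  moreover have "(\<Union>i\<in>UNIV. {i} \<times> UNIV) = (UNIV :: ('c discrete \<times> 'a) set)" by auto
  ultimately show ?thesis by simp
qed

context green_graph
begin

definition green :: "(nat \<Rightarrow> real \<Rightarrow> real) \<Rightarrow> nat \<Rightarrow> real \<Rightarrow> real" where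
  "green g i x = Y g (src i) + D g i * x - src2 g i x"

lemma green_deriv:
  assumes "edge_cont g" "i < n" "x \<in> {0..len i}"
  shows "(green g i has_real_derivative D g i - src1 g i x) (at x within {0..len i})"
  unfolding green_def using src2_deriv[OF assms] by (auto intro!: derivative_eq_intros)

lemma green_cont: "edge_cont g \<Longrightarrow> edge_cont (green g)"
  unfolding edge_cont_def[of "green g"] by (meson DERIV_continuous_on green_deriv)

lemma edge_cont_compose:
  "edge_cont V \<Longrightarrow> continuous_on UNIV f \<Longrightarrow> edge_cont (\<lambda>i x. f (V i x))"
  unfolding edge_cont_def by (auto intro: continuous_on_compose2)

text \<open>Contraction with factor 1/2 for each \<open>s\<close>. The Lipschitz dependence on
  \<open>s\<close>, with constant \<open>1 / (1 - 1/2) = 2\<close>, is what the later intermediate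
  value argument needs.\<close>

lemma semilinear_solution:
  assumes f: "\<And>x y. \<bar>f x - f y\<bar> \<le> L * \<bar>x - y\<bar>" and \<kappa>: "0 \<le> \<kappa>" "\<kappa> * C * L \<le> 1 / 2" and L: "0 \<le> L"
  obtains V :: "real \<Rightarrow> nat \<Rightarrow> real \<Rightarrow> real" where
    "\<And>s. edge_cont (V s)"
    "\<And>s i x. \<lbrakk>i < n; x \<in> {0..len i}\<rbrakk> \<Longrightarrow> V s i x = s + \<kappa> * green (\<lambda>i x. f (V s i x)) i x"
    "\<And>s s' i x. \<bar>V s i x - V s' i x\<bar> \<le> 2 * \<bar>s - s'\<bar>"
proof -
  \<comment> \<open>Clamping the position to the edge extends the functions to all of
    \<open>real\<close>, so that the complete space of bounded continuous functions can be
    used.\<close>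
  define cl where "cl = (\<lambda>i x. max 0 (min x (len i)))"
  have cl_mem: "cl i x \<in> {0..len i}" if "i < n" for i x
    using len_pos[OF that] by (auto simp: cl_def)
  have cl_id: "cl i x = x" if "x \<in> {0..len i}" for i x using that by (auto simp: cl_def)
  have f_cont: "continuous_on UNIV f"
  proof (rule continuous_on_iff[THEN iffD2], intro ballI allI impI)
    fix x e :: real assume "0 < e"
    show "\<exists>d>0. \<forall>x'\<in>UNIV. dist x' x < d \<longrightarrow> dist (f x') (f x) < e"
    proof (intro exI[of _ "e / (L + 1)"] conjI ballI impI)
      show "0 < e / (L + 1)" using \<open>0 < e\<close> L by simp
      fix x' assume "dist x' x < e / (L + 1)"
      then have "(L + 1) * \<bar>x' - x\<bar> < e" using L by (simp add: dist_real_def field_simps)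
      moreover have "L * \<bar>x' - x\<bar> \<le> (L + 1) * \<bar>x' - x\<bar>" by (simp add: mult_right_mono)
      ultimately show "dist (f x') (f x) < e" using f[of x' x] by (simp add: dist_real_def)
    qed
  qed
  \<comment> \<open>Functions on the disjoint union of the edges become bounded continuous functions of an edge
    index, with the discrete metric, and a position.\<close>
  define rhs where "rhs = (\<lambda>(s::real) (W :: (nat discrete \<times> real) \<Rightarrow>\<^sub>C real) (z :: nat discrete \<times> real).
    if of_discrete (fst z) < n then s + \<kappa> * green (\<lambda>i x. f (W (discrete i, x))) (of_discrete (fst z)) (cl (of_discrete (fst z)) (snd z)) else s)"
  have slice_cont: "continuous_on S (\<lambda>x. W (discrete i, x))" for W :: "(nat discrete \<times> real) \<Rightarrow>\<^sub>C real" and i S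
    by (rule continuous_on_compose2[OF continuous_on_apply_bcontfun[of UNIV W]])
      (intro continuous_intros, rule subset_UNIV)
  have W_cont: "edge_cont (\<lambda>i x. f (W (discrete i, x)))" for W :: "(nat discrete \<times> real) \<Rightarrow>\<^sub>C real"
    by (rule edge_cont_compose[OF _ f_cont]) (simp add: edge_cont_def slice_cont)
  have rhs_cont: "continuous_on UNIV (\<lambda>x. rhs s W (j, x))" for s W j
  proof (cases "of_discrete j < n")
    case True
    have "continuous_on UNIV (\<lambda>x. green (\<lambda>i x. f (W (discrete i, x))) (of_discrete j) (cl (of_discrete j) x))"
      by (rule continuous_on_compose2[of "{0..len (of_discrete j)}"])
        (use green_cont[OF W_cont] True cl_mem in \<open>auto simp: edge_cont_def cl_def intro!: continuous_intros\<close>)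
    then show ?thesis using True by (auto simp: rhs_def intro!: continuous_intros)
  qed (simp add: rhs_def)
  have rhs_bounded: "bounded (range (rhs s W))" for s W
  proof -
    let ?g = "\<lambda>i x. s + \<kappa> * green (\<lambda>i x. f (W (discrete i, x))) i x"
    have "range (rhs s W) \<subseteq> insert s (\<Union>i<n. ?g i ` {0..len i})"
      using cl_mem by (auto simp: rhs_def)
    moreover have "bounded (?g i ` {0..len i})" if "i < n" for i
      using green_cont[OF W_cont] that
      by (intro compact_imp_bounded compact_continuous_image) (auto simp: edge_cont_def intro!: continuous_intros)
    ultimately show ?thesis
      by (elim bounded_subset[rotated]) auto
  qed
  define T where "T = (\<lambda>s W. Bcontfun (rhs s W))"
  have T: "apply_bcontfun (T s W) z = rhs s W z" for s W z
    unfolding T_def using rhs_bounded continuous_on_discrete_prod[OF rhs_cont]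
    by (subst Bcontfun_inverse) (auto simp: bcontfun_def)
  \<comment> \<open>Varying both arguments at once serves twice: \<open>s = s'\<close> gives the
    contraction, and fixed points for different \<open>s\<close> give the Lipschitz bound.\<close>
  have T_dist: "dist (T s W) (T s' W') \<le> \<bar>s - s'\<bar> + 1 / 2 * dist W W'" for s s' W W'
  proof (rule dist_bound)
    fix z :: "nat discrete \<times> real"
    show "dist (T s W z) (T s' W' z) \<le> \<bar>s - s'\<bar> + 1 / 2 * dist W W'"
    proof (cases "of_discrete (fst z) < n")
      case True
      have "\<bar>f (W (discrete i, t)) - f (W' (discrete i, t))\<bar> \<le> L * dist W W'" for i t
        using f[of "W (discrete i, t)" "W' (discrete i, t)"] mult_left_mono[OF dist_bounded[of W "(discrete i, t)" W'] L]
        by (simp add: dist_real_def)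
      then have "\<bar>green (\<lambda>i x. f (W (discrete i, x))) (of_discrete (fst z)) (cl (of_discrete (fst z)) (snd z))
         - green (\<lambda>i x. f (W' (discrete i, x))) (of_discrete (fst z)) (cl (of_discrete (fst z)) (snd z))\<bar> \<le> C * (L * dist W W')"
        unfolding green_def using L W_cont cl_mem True
        by (intro green_diff) auto
      then have "\<kappa> * \<bar>green (\<lambda>i x. f (W (discrete i, x))) (of_discrete (fst z)) (cl (of_discrete (fst z)) (snd z))
         - green (\<lambda>i x. f (W' (discrete i, x))) (of_discrete (fst z)) (cl (of_discrete (fst z)) (snd z))\<bar> \<le> \<kappa> * C * L * dist W W'"
        using \<kappa>(1) by (simp add: mult_left_mono mult.assoc)
      also have "\<dots> \<le> 1 / 2 * dist W W'" using \<kappa>(2) by (intro mult_right_mono) auto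
      finally have "\<bar>\<kappa> * green (\<lambda>i x. f (W (discrete i, x))) (of_discrete (fst z)) (cl (of_discrete (fst z)) (snd z))
         - \<kappa> * green (\<lambda>i x. f (W' (discrete i, x))) (of_discrete (fst z)) (cl (of_discrete (fst z)) (snd z))\<bar> \<le> 1 / 2 * dist W W'"
        using \<kappa>(1) by (simp add: abs_mult flip: right_diff_distrib)
      moreover have "\<bar>(s + a) - (s' + b)\<bar> \<le> \<bar>s - s'\<bar> + \<bar>a - b\<bar>" for a b by linarith
      ultimately show ?thesis using True unfolding T rhs_def dist_real_def
        by (simp only: if_True)
    qed (auto simp: T rhs_def dist_real_def)
  qed
  have "\<exists>W. T s W = W" for s
    using banach_fix_type[of "1/2" "T s"] T_dist[of s _ s] by auto
  then obtain W where W: "\<And>s. T s (W s) = W s" by metis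
  show thesis
  proof (rule that[of "\<lambda>s i x. W s (discrete i, x)"])
    show "edge_cont (\<lambda>i x. W s (discrete i, x))" for s
      by (simp add: edge_cont_def slice_cont)
    show "W s (discrete i, x) = s + \<kappa> * green (\<lambda>i x. f (W s (discrete i, x))) i x" if "i < n" "x \<in> {0..len i}" for s i x
      using T[of s "W s" "(discrete i, x)"] that cl_id by (simp add: W rhs_def discrete_inverse)
    show "\<bar>W s (discrete i, x) - W s' (discrete i, x)\<bar> \<le> 2 * \<bar>s - s'\<bar>" for s s' i x
      using T_dist[of s "W s" s' "W s'"] dist_bounded[of "W s" "(discrete i, x)" "W s'"]
      by (simp add: W dist_real_def)
  qed
qed

end

section \<open>Soliton on the half-line\<close>

text \<open>Throughout, \<open>p = 2 * k + 2\<close>; the soliton is the positive even solution of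
  \<open>\<phi>'' + \<phi>\<^sup>p\<^sup>-\<^sup>1 = \<phi>\<close> vanishing at infinity.\<close>
definition soliton :: "real \<Rightarrow> real \<Rightarrow> real" where
  "soliton k x = (k + 1) powr (1 / (2 * k)) * cosh (k * x) powr (- (1 / k))"

definition nonlin :: "real \<Rightarrow> real \<Rightarrow> real" where
  "nonlin k y = y powr (2 * k + 1) - y"

lemma one_minus_tanh_sq: "1 - (tanh x)\<^sup>2 = 1 / (cosh x)\<^sup>2" for x :: real
proof -
  have "1 - (tanh x)\<^sup>2 = ((cosh x)\<^sup>2 - (sinh x)\<^sup>2) / (cosh x)\<^sup>2"
    by (simp add: tanh_def power_divide diff_divide_distrib)
  then show ?thesis by (simp only: hyperbolic_pythagoras)
qed

context
  fixes k :: real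
  assumes k: "0 < k"
begin

lemma soliton_pos: "0 < soliton k x"
  using k by (simp add: soliton_def)

lemma soliton_deriv: "(soliton k has_real_derivative - soliton k x * tanh (k * x)) (at x)"
proof -
  have "((\<lambda>x. cosh (k * x) powr (- (1 / k))) has_real_derivative
      (- (1 / k)) * cosh (k * x) powr (- (1 / k) - 1) * (sinh (k * x) * k)) (at x)"
    by (rule DERIV_chain2[OF has_real_derivative_powr]) (auto intro!: derivative_eq_intros)
  moreover have "(- (1 / k)) * cosh (k * x) powr (- (1 / k) - 1) * (sinh (k * x) * k)
      = - (cosh (k * x) powr (- (1 / k)) * tanh (k * x))"
    using k by (simp add: powr_diff tanh_def)
  ultimately have "((\<lambda>x. cosh (k * x) powr (- (1 / k))) has_real_derivative
      - (cosh (k * x) powr (- (1 / k)) * tanh (k * x))) (at x)" by metis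
  from DERIV_cmult[OF this, of "(k + 1) powr (1 / (2 * k))"]
  show ?thesis by (simp add: soliton_def[abs_def] mult.assoc)
qed

text \<open>The exponent \<open>2 k\<close> undoes the root in the definition, so the nonlinear
  terms become polynomial in the hyperbolic tangent.\<close>

lemma soliton_powr: "soliton k x powr (2 * k) = (k + 1) * (1 - (tanh (k * x))\<^sup>2)"
proof -
  have "cosh (k * x) powr (- 2) = 1 / (cosh (k * x))\<^sup>2"
    using cosh_real_pos[of "k * x"] by (simp add: powr_minus inverse_eq_divide powr_numeral)
  then show ?thesis
    using k unfolding soliton_def one_minus_tanh_sq
    by (simp add: powr_mult powr_powr less_imp_le)
qed

lemma soliton_deriv2:
  "((\<lambda>x. - soliton k x * tanh (k * x)) has_real_derivative - nonlin k (soliton k x)) (at x)"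
proof -
  have "((\<lambda>x. - soliton k x * tanh (k * x)) has_real_derivative
      - (- soliton k x * tanh (k * x)) * tanh (k * x)
      + (1 - (tanh (k * x))\<^sup>2) * k * - soliton k x) (at x)"
    by (rule derivative_eq_intros soliton_deriv refl | simp)+
  moreover have "soliton k x powr (2 * k + 1) = (k + 1) * (1 - (tanh (k * x))\<^sup>2) * soliton k x"
    using soliton_pos[of x] by (simp add: powr_add soliton_powr)
  ultimately show ?thesis
    by (elim DERIV_cong) (simp add: nonlin_def power2_eq_square algebra_simps)
qed

text \<open>The soliton lies on the zero level of its first integral, as its decay suggests. This
  makes the conserved quantity vanish on the half-line and expresses the potential at the junction
  through the slope there.\<close>

lemma soliton_hamiltonian:
  "soliton k x powr (2 * k + 2) / (2 * k + 2) - (soliton k x)\<^sup>2 / 2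
     = - (soliton k x * tanh (k * x))\<^sup>2 / 2"
proof -
  have "soliton k x powr (2 * k + 2) = (k + 1) * (1 - (tanh (k * x))\<^sup>2) * (soliton k x)\<^sup>2"
    using soliton_pos[of x] by (simp add: powr_add soliton_powr powr_numeral)
  also have "\<dots> / (2 * k + 2) = (1 - (tanh (k * x))\<^sup>2) * (soliton k x)\<^sup>2 / 2"
    using k by (simp add: field_simps)
  finally show ?thesis by (simp add: power_mult_distrib algebra_simps diff_divide_distrib)
qed

lemma soliton_le_max: "soliton k x \<le> soliton k 0"
proof -
  have "cosh (k * x) powr (- (1 / k)) \<le> 1 powr (- (1 / k))"
    using k cosh_real_ge_1[of "k * x"] by (intro powr_mono2') auto
  then show ?thesis using k by (simp add: soliton_def mult_left_le)
qed

lemma soliton_ge: "0 \<le> x \<Longrightarrow> soliton k 0 * exp (- x) \<le> soliton k x"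
proof -
  assume x: "0 \<le> x"
  have "cosh (k * x) \<le> exp (k * x)"
    using k x by (simp add: cosh_def)
  then have "exp (k * x) powr (- (1 / k)) \<le> cosh (k * x) powr (- (1 / k))"
    using k by (intro powr_mono2') auto
  moreover have "exp (k * x) powr (- (1 / k)) = exp (- x)" using k by (simp add: exp_powr_real)
  ultimately show ?thesis using k by (simp add: soliton_def mult_left_mono)
qed

lemma soliton_le: "soliton k x \<le> soliton k 0 * 2 powr (1 / k) * exp (- x)"
proof -
  have "exp (k * x) / 2 \<le> cosh (k * x)" by (simp add: cosh_def)
  then have "cosh (k * x) powr (- (1 / k)) \<le> (exp (k * x) / 2) powr (- (1 / k))"
    using k by (intro powr_mono2') auto
  moreover have "(exp (k * x) / 2) powr (- (1 / k)) = 2 powr (1 / k) * exp (- x)"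
    using k by (simp add: powr_divide exp_powr_real powr_minus_divide exp_minus inverse_eq_divide)
  ultimately show ?thesis using k by (simp add: soliton_def mult_left_mono mult.assoc)
qed

end

section \<open>Explicit soliton bounds, uniform in the exponent\<close>

lemma soliton_0: "soliton k 0 = (k + 1) powr (1 / (2 * k))"
  by (simp add: soliton_def)

text \<open>The range of \<open>k\<close> corresponds to \<open>p\<close> in \<open>[6, 7]\<close>.
  Numerical bounds on this range allow the frequency to be chosen independently of
  \<open>p\<close>.\<close>

lemma soliton_0_bounds:
  assumes "2 \<le> k" "k \<le> 5 / 2"
  shows "1 \<le> soliton k 0" "soliton k 0 \<le> 2"
proof -
  show "1 \<le> soliton k 0" using assms by (simp add: soliton_0 ge_one_powr_ge_zero)
  have "(k + 1) powr (1 / (2 * k)) \<le> (k + 1) powr (1 / 4)"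
    using assms by (intro powr_mono) (auto simp: field_simps)
  also have "\<dots> \<le> 16 powr (1 / 4)" using assms by (intro powr_mono2) auto
  also have "\<dots> = 2" 
  proof -
    have "(16::real) = 2 powr 4" by (simp add: powr_numeral)
    then show ?thesis by (simp only: powr_powr) simp
  qed
  finally show "soliton k 0 \<le> 2" by (simp add: soliton_0)
qed

lemma nonlin_soliton_0:
  assumes "2 \<le> k"
  shows "nonlin k (soliton k 0) = k * soliton k 0"
proof -
  have "soliton k 0 powr (2 * k + 1) = (k + 1) * soliton k 0"
    using assms soliton_pos[of k 0] soliton_powr[of k 0] by (simp add: powr_add)
  then show ?thesis by (simp add: nonlin_def algebra_simps)
qed

text \<open>By the mean value theorem the drop is at most the shift times a slope before
  \<open>a\<close>, and that slope is controlled by \<open>tanh (k * a)\<close>. The matching of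
  fluxes makes this quantity small, so the junction value stays near the maximum.\<close>

lemma soliton_drop_le:
  assumes "2 \<le> k" "k \<le> 5 / 2" "0 \<le> a" "a \<le> 1"
  shows "soliton k 0 - soliton k a \<le> 2 * tanh (k * a)"
proof (cases "a = 0")
  case False
  then have "0 < a" using assms by simp
  then obtain z where z: "0 < z" "z < a" "soliton k a - soliton k 0 = (a - 0) * (- soliton k z * tanh (k * z))"
    using MVT2[of 0 a "soliton k" "\<lambda>x. - soliton k x * tanh (k * x)"] soliton_deriv[of k] assms by auto
  have "soliton k z \<le> 2" using soliton_le_max[of k z] soliton_0_bounds[of k] assms by linarith
  moreover have "tanh (k * z) \<le> tanh (k * a)" "0 \<le> tanh (k * z)" using z assms by auto
  ultimately have "soliton k z * tanh (k * z) \<le> 2 * tanh (k * a)"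
    using soliton_pos[of k z] assms by (intro mult_mono) auto
  moreover have "a * (soliton k z * tanh (k * z)) \<le> 1 * (soliton k z * tanh (k * z))"
    using soliton_pos[of k z] assms \<open>0 \<le> tanh (k * z)\<close> by (intro mult_right_mono) (auto simp: less_imp_le)
  ultimately show ?thesis using z(3) by simp
qed simp

text \<open>A slope bounded below at shift 1 supplies the upper sign in the intermediate value
  argument.\<close>

lemma soliton_slope_ge:
  assumes "2 \<le> k" "k \<le> 5 / 2"
  shows "1 / 6 \<le> soliton k 1 * tanh k"
proof -
  have "1 / 3 \<le> exp (- 1 :: real)" using exp_le by (simp add: exp_minus field_simps)
  moreover have "soliton k 0 * exp (- 1) \<le> soliton k 1" using soliton_ge[of k 1] assms by simp
  moreover have "1 * exp (- 1) \<le> soliton k 0 * exp (- 1 :: real)"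
    using soliton_0_bounds[OF assms] by (intro mult_right_mono) auto
  ultimately have s: "1 / 3 \<le> soliton k 1" by linarith
  have "exp (- 2 * k) \<le> 1 / 3"
  proof -
    have "3 \<le> exp (2 * k)" using exp_ge_add_one_self[of "2 * k"] assms by linarith
    then show ?thesis by (simp add: exp_minus field_simps)
  qed
  then have "1 / 2 \<le> tanh k"
    unfolding tanh_real_altdef by (simp add: field_simps add_pos_pos)
  with s have "1 / 3 * (1 / 2) \<le> soliton k 1 * tanh k" by (intro mult_mono) auto
  then show ?thesis by simp
qed

lemma soliton_nonneg_ge_third:
  assumes "2 \<le> k" "k \<le> 5 / 2" "0 \<le> a" "a \<le> 1"
  shows "1 / 3 \<le> soliton k a"
proof -
  have "1 / 3 \<le> exp (- 1 :: real)" using exp_le by (simp add: exp_minus field_simps)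
  also have "\<dots> \<le> exp (- a)" using assms by simp
  also have "\<dots> \<le> soliton k 0 * exp (- a)" using soliton_0_bounds[OF assms(1,2)] by simp
  also have "\<dots> \<le> soliton k a" using soliton_ge[of k a] assms by simp
  finally show ?thesis .
qed

lemma set_integrable_exp_decay:
  fixes h :: "real \<Rightarrow> real"
  assumes "0 < b" "continuous_on {0..} h" "\<And>x. 0 \<le> x \<Longrightarrow> \<bar>h x\<bar> \<le> M * exp (- b * x)"
  shows "set_integrable lborel {0..} h" "(LBINT x:{0..}. h x) \<le> M / b"
proof -
  have F: "((\<lambda>x. - exp (- b * x) / b) has_real_derivative exp (- b * x)) (at x)" for x
    using assms(1) by (auto intro!: derivative_eq_intros)
  have lim: "((\<lambda>x. - exp (- b * x) / b) \<longlongrightarrow> 0) at_top"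
    using assms(1) by real_asymp
  have nn: "(\<integral>\<^sup>+x. ennreal (exp (- b * x)) * indicator {0..} x \<partial>lborel) = ennreal (1 / b)"
    using nn_integral_FTC_atLeast[of "\<lambda>x. exp (- b * x)" 0 "\<lambda>x. - exp (- b * x) / b" 0] F lim by simp
  have e1: "set_integrable lborel {0..} (\<lambda>x. exp (- b * x))"
    unfolding set_integrable_def
    by (rule integrableI_nn_integral_finite[where x = "1 / b"])
      (use nn assms(1) in \<open>auto simp: ennreal_mult'' ennreal_indicator[symmetric] mult.commute\<close>)
  have e2: "(LBINT x:{0..}. exp (- b * x)) = 1 / b"
    unfolding set_lebesgue_integral_def
    by (rule integral_eq_nn_integral[THEN trans])
      (use nn assms(1) in \<open>auto simp: ennreal_mult'' ennreal_indicator[symmetric] mult.commute\<close>)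
  have meas: "set_borel_measurable lborel {0..} h"
    using borel_measurable_continuous_on_indicator[OF _ assms(2)]
    by (simp add: set_borel_measurable_def)
  have eM: "set_integrable lborel {0..} (\<lambda>x. M * exp (- b * x))"
    using e1 by (rule set_integrable_mult_right)
  show int: "set_integrable lborel {0..} h"
    by (rule set_integrable_bound[OF eM meas]) (auto intro!: AE_I2 order_trans[OF assms(3)])
  have "(LBINT x:{0..}. h x) \<le> (LBINT x:{0..}. M * exp (- b * x))"
    using int eM assms(3) by (intro set_integral_mono) (auto simp: abs_le_iff)
  also have "\<dots> = M / b" using e2 by simp
  finally show "(LBINT x:{0..}. h x) \<le> M / b" .
qed

section \<open>Energy identities along solutions of the ODE\<close>

lemma ode_sol_on_subset:
  "ode_sol_on S p lam u du \<Longrightarrow> T \<subseteq> S \<Longrightarrow> ode_sol_on T p lam u du"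
  unfolding ode_sol_on_def by (meson has_field_derivative_subset subsetD)

lemma ode_sol_on_continuous: "ode_sol_on S p lam u du \<Longrightarrow> continuous_on S u"
  unfolding ode_sol_on_def by (blast intro: DERIV_continuous_on)

lemma LBINT_Icc_eq_integral:
  fixes f :: "real \<Rightarrow> real"
  shows "continuous_on {a..b} f \<Longrightarrow> (LBINT x:{a..b}. f x) = integral {a..b} f"
  by (rule set_borel_integral_eq_integral(2)[OF borel_integrable_atLeastAtMost'])

text \<open>With the conserved quantity \<open>h = u'\<^sup>2 / 2 + u\<^sup>p / p - lam u\<^sup>2 / 2\<close>, the energy density equals
  \<open>h / 2 + (u u')' / 4 + (p - 6) u\<^sup>p / (4 p)\<close>.\<close>
lemma ode_energy_Icc:
  assumes ode: "ode_sol_on {0..l} p lam u du" and "0 \<le> l" "0 < p"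
    and pos: "\<And>x. x \<in> {0..l} \<Longrightarrow> 0 < u x"
    and h: "h = (du 0)\<^sup>2 / 2 + u 0 powr p / p - lam * (u 0)\<^sup>2 / 2"
  shows "1 / 2 * (LBINT x:{0..l}. (du x)\<^sup>2) - 1 / p * (LBINT x:{0..l}. \<bar>u x\<bar> powr p)
     = h * l / 2 + (u l * du l - u 0 * du 0) / 4 + (p - 6) / (4 * p) * (LBINT x:{0..l}. \<bar>u x\<bar> powr p)"
proof -
  from ode obtain ddu where
    du: "\<And>x. x \<in> {0..l} \<Longrightarrow> (u has_real_derivative du x) (at x within {0..l})"
    and ddu: "\<And>x. x \<in> {0..l} \<Longrightarrow> (du has_real_derivative ddu x) (at x within {0..l})"
    and eq: "\<And>x. x \<in> {0..l} \<Longrightarrow> ddu x = lam * u x - u x powr (p - 1)"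
    unfolding ode_sol_on_def by (metis add_diff_cancel_right')
  have cu: "continuous_on {0..l} u" and cdu: "continuous_on {0..l} du"
    using du ddu by (meson DERIV_continuous_on)+
  define H where "H = (\<lambda>x. (du x)\<^sup>2 / 2 + u x powr p / p - lam * (u x)\<^sup>2 / 2)"
  have powr_p: "u x powr p = u x * u x powr (p - 1)" if "x \<in> {0..l}" for x
    using pos[OF that] by (simp add: powr_diff)
  have "(H has_real_derivative 0) (at x within {0..l})" if x: "x \<in> {0..l}" for x
  proof -
    have P: "((\<lambda>y. u y powr p) has_real_derivative p * u x powr (p - 1) * du x) (at x within {0..l})"
      by (rule DERIV_chain2[OF has_real_derivative_powr du]) (use pos x in auto)
    have Q: "((\<lambda>y. (u y)\<^sup>2) has_real_derivative 2 * u x * du x) (at x within {0..l})"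
      "((\<lambda>y. (du y)\<^sup>2) has_real_derivative 2 * du x * ddu x) (at x within {0..l})"
      using DERIV_power[OF du[OF x], of 2] DERIV_power[OF ddu[OF x], of 2]
      by (simp_all add: mult.commute mult.left_commute)
    have "(H has_real_derivative 2 * du x * ddu x / 2 + p * u x powr (p - 1) * du x / p
        - lam * (2 * u x * du x) / 2) (at x within {0..l})"
      unfolding H_def by (intro DERIV_add DERIV_diff DERIV_cdivide DERIV_cmult P Q)
    then show ?thesis
      using \<open>0 < p\<close> by (elim DERIV_cong) (simp add: eq[OF x] field_simps)
  qed
  then obtain c where "\<And>x. x \<in> {0..l} \<Longrightarrow> H x = c"
    using has_field_derivative_zero_constant[of "{0..l}" H] by auto
  then have Hh: "H x = h" if "x \<in> {0..l}" for x
    using that \<open>0 \<le> l\<close> by (metis H_def h atLeastAtMost_iff order_refl)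
  \<comment> \<open>Eliminating \<open>lam u^2\<close> by means of \<open>H\<close> leaves only
    \<open>u'^2\<close>, \<open>u^p\<close> and the constant. When \<open>u'^2\<close> is then
    eliminated from the energy density, the coefficient of \<open>u^p\<close> is
    \<open>1/4 - 3/(2 p)\<close>, which is zero exactly at \<open>p = 6\<close>.\<close>
  have deriv: "((\<lambda>x. u x * du x / 4) has_real_derivative
      (2 * (du x)\<^sup>2 + (2 / p - 1) * \<bar>u x\<bar> powr p - 2 * h) / 4) (at x within {0..l})"
    if x: "x \<in> {0..l}" for x
  proof -
    have lam: "lam * (u x)\<^sup>2 = (du x)\<^sup>2 + 2 * u x powr p / p - 2 * h"
      using Hh[OF x] by (simp add: H_def field_simps)
    have "((\<lambda>x. u x * du x / 4) has_real_derivative (du x * du x + ddu x * u x) / 4) (at x within {0..l})"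
      by (rule derivative_eq_intros du[OF x] ddu[OF x] refl | simp)+
    moreover have "du x * du x + ddu x * u x = (du x)\<^sup>2 + lam * (u x)\<^sup>2 - u x powr p"
      unfolding eq[OF x] powr_p[OF x] by (simp add: power2_eq_square algebra_simps)
    then have "du x * du x + ddu x * u x = 2 * (du x)\<^sup>2 + (2 / p - 1) * \<bar>u x\<bar> powr p - 2 * h"
      using pos[OF x] unfolding lam by (simp add: algebra_simps)
    ultimately show ?thesis by simp
  qed
  have cp: "continuous_on {0..l} (\<lambda>x. \<bar>u x\<bar> powr p)"
    using cu pos by (intro continuous_intros) force+
  have cd: "continuous_on {0..l} (\<lambda>x. (du x)\<^sup>2)" using cdu by (intro continuous_intros)
  have "((\<lambda>x. (2 * (du x)\<^sup>2 + (2 / p - 1) * \<bar>u x\<bar> powr p - 2 * h) / 4) has_integral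
      u l * du l / 4 - u 0 * du 0 / 4) {0..l}"
    using deriv \<open>0 \<le> l\<close>
    by (intro fundamental_theorem_of_calculus) (auto simp: has_real_derivative_iff_has_vector_derivative)
  moreover have "((\<lambda>x. (2 * (du x)\<^sup>2 + (2 / p - 1) * \<bar>u x\<bar> powr p - 2 * h) / 4) has_integral
      (2 * integral {0..l} (\<lambda>x. (du x)\<^sup>2) + (2 / p - 1) * integral {0..l} (\<lambda>x. \<bar>u x\<bar> powr p) - 2 * h * l) / 4) {0..l}"
  proof -
    have "((\<lambda>x. 2 * h) has_integral 2 * h * l) {0..l}"
      using has_integral_const_real[of "2 * h" 0 l] \<open>0 \<le> l\<close> by (simp add: mult.commute)
    then show ?thesis
      by (intro has_integral_divide has_integral_diff has_integral_add has_integral_mult_right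
          integrable_integral integrable_continuous_real cp cd)
  qed
  ultimately have "u l * du l / 4 - u 0 * du 0 / 4 = (2 * integral {0..l} (\<lambda>x. (du x)\<^sup>2)
      + (2 / p - 1) * integral {0..l} (\<lambda>x. \<bar>u x\<bar> powr p) - 2 * h * l) / 4"
    by (rule has_integral_unique)
  then show ?thesis
    using \<open>0 < p\<close> unfolding LBINT_Icc_eq_integral[OF cp] LBINT_Icc_eq_integral[OF cd]
    by (simp add: field_simps)
qed

text \<open>The limit of the identity on \<open>[0, l]\<close>: at zero level the contribution
  proportional to \<open>l\<close> is absent, and decay removes the boundary term at
  \<open>l\<close>.\<close>

lemma ode_energy_half_line:
  assumes ode: "ode_sol_on {0..} p lam u du" and "0 < p"
    and pos: "\<And>x. 0 \<le> x \<Longrightarrow> 0 < u x"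
    and h: "(du 0)\<^sup>2 / 2 + u 0 powr p / p - lam * (u 0)\<^sup>2 / 2 = 0"
    and int: "set_integrable lborel {0..} (\<lambda>x. (du x)\<^sup>2)" "set_integrable lborel {0..} (\<lambda>x. \<bar>u x\<bar> powr p)"
    and lim: "((\<lambda>x. u x * du x) \<longlongrightarrow> 0) at_top"
  shows "1 / 2 * (LBINT x:{0..}. (du x)\<^sup>2) - 1 / p * (LBINT x:{0..}. \<bar>u x\<bar> powr p)
     = - (u 0 * du 0) / 4 + (p - 6) / (4 * p) * (LBINT x:{0..}. \<bar>u x\<bar> powr p)"
proof (rule tendsto_unique[OF trivial_limit_at_top_linorder])
  let ?A = "\<lambda>l. 1 / 2 * (LBINT x:{0..l}. (du x)\<^sup>2) - 1 / p * (LBINT x:{0..l}. \<bar>u x\<bar> powr p)"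
  let ?B = "\<lambda>l. (u l * du l - u 0 * du 0) / 4 + (p - 6) / (4 * p) * (LBINT x:{0..l}. \<bar>u x\<bar> powr p)"
  have T: "((\<lambda>l. LBINT x:{0..l}. (du x)\<^sup>2) \<longlongrightarrow> (LBINT x:{0..}. (du x)\<^sup>2)) at_top"
    "((\<lambda>l. LBINT x:{0..l}. \<bar>u x\<bar> powr p) \<longlongrightarrow> (LBINT x:{0..}. \<bar>u x\<bar> powr p)) at_top"
    using int by (intro tendsto_set_lebesgue_integral_at_top; simp)+
  show "(?A \<longlongrightarrow> 1 / 2 * (LBINT x:{0..}. (du x)\<^sup>2) - 1 / p * (LBINT x:{0..}. \<bar>u x\<bar> powr p)) at_top"
    by (intro tendsto_intros T)
  have "(?B \<longlongrightarrow> (0 - u 0 * du 0) / 4 + (p - 6) / (4 * p) * (LBINT x:{0..}. \<bar>u x\<bar> powr p)) at_top"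
    by (intro tendsto_intros T lim) simp
  moreover have "\<forall>\<^sub>F l in at_top. ?A l = ?B l"
    using eventually_ge_at_top[of 0]
  proof eventually_elim
    case (elim l)
    then show ?case
      using ode_energy_Icc[of l p lam u du 0] ode_sol_on_subset[OF ode, of "{0..l}"] assms(2) pos h
      by simp
  qed
  ultimately show "(?A \<longlongrightarrow> - (u 0 * du 0) / 4 + (p - 6) / (4 * p) * (LBINT x:{0..}. \<bar>u x\<bar> powr p)) at_top"
    by (subst tendsto_cong) auto
qed

text \<open>The condition on \<open>c\<close> balances the two scalings: two derivatives produce
  \<open>\<epsilon>^2\<close>, and the nonlinearity produces \<open>c powr (2 * k)\<close>.\<close>

lemma scaled_soliton:
  fixes k \<epsilon> c a :: real
  assumes uh_def: "uh = (\<lambda>x. c * soliton k (\<epsilon> * x + a))"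
    and duh_def: "duh = (\<lambda>x. - (c * \<epsilon> * soliton k (\<epsilon> * x + a) * tanh (k * (\<epsilon> * x + a))))"
    and k: "2 \<le> k" "k \<le> 5 / 2" and \<epsilon>: "0 < \<epsilon>" "\<epsilon> \<le> 1" and c: "0 < c" "c powr (2 * k) = \<epsilon>\<^sup>2" and a: "0 \<le> a"
  shows "ode_sol_on {0..} (2 * k + 2) (\<epsilon>\<^sup>2) uh duh" (is ?ode)
    and "\<And>x. 0 < uh x"
    and "set_integrable lborel {0..} (\<lambda>x. (uh x)\<^sup>2)"
    and "set_integrable lborel {0..} (\<lambda>x. (duh x)\<^sup>2)" (is ?int)
    and "(LBINT x:{0..}. \<bar>uh x\<bar> powr (2 * k + 2)) \<le> 28 * c\<^sup>2"
    and "1 / 2 * (LBINT x:{0..}. (duh x)\<^sup>2) - 1 / (2 * k + 2) * (LBINT x:{0..}. \<bar>uh x\<bar> powr (2 * k + 2))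
     = - (uh 0 * duh 0) / 4 + (2 * k + 2 - 6) / (4 * (2 * k + 2)) * (LBINT x:{0..}. \<bar>uh x\<bar> powr (2 * k + 2))"
proof -
  have k0: "0 < k" using k by simp
  let ?s = "\<lambda>x. soliton k (\<epsilon> * x + a)" and ?t = "\<lambda>x. tanh (k * (\<epsilon> * x + a))"
  have powr_c: "c powr (2 * k + 1) = c * \<epsilon>\<^sup>2" "c powr (2 * k + 2) = c\<^sup>2 * \<epsilon>\<^sup>2"
    using c by (simp_all add: powr_add powr_numeral)
  have lin: "((\<lambda>x. \<epsilon> * x + a) has_real_derivative \<epsilon>) (at x within S)" for x S
    by (auto intro!: derivative_eq_intros)
  show pos: "0 < uh x" for x using c soliton_pos[OF k0] by (simp add: uh_def)
  have d1: "(uh has_real_derivative duh x) (at x within S)" for x S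
  proof -
    have "((\<lambda>x. ?s x) has_real_derivative (- ?s x * ?t x) * \<epsilon>) (at x within S)"
      by (rule DERIV_chain2[OF soliton_deriv[OF k0] lin])
    from DERIV_cmult[OF this, of c] show ?thesis unfolding uh_def duh_def by (simp add: ac_simps)
  qed
  have d2: "(duh has_real_derivative (\<epsilon>\<^sup>2 * uh x - uh x powr (2 * k + 1))) (at x within S)" for x S
  proof -
    have "((\<lambda>x. - ?s x * ?t x) has_real_derivative - nonlin k (?s x) * \<epsilon>) (at x within S)"
      by (rule DERIV_chain2[OF soliton_deriv2[OF k0] lin])
    from DERIV_cmult[OF this, of "c * \<epsilon>"]
    have "(duh has_real_derivative c * \<epsilon> * (- nonlin k (?s x) * \<epsilon>)) (at x within S)"
      unfolding duh_def by (simp add: ac_simps)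
    moreover have "uh x powr (2 * k + 1) = c * \<epsilon>\<^sup>2 * ?s x powr (2 * k + 1)"
      using c soliton_pos[OF k0, of "\<epsilon> * x + a"] by (simp add: uh_def powr_mult less_imp_le powr_c)
    ultimately show ?thesis
      by (elim DERIV_cong) (simp add: nonlin_def uh_def power2_eq_square algebra_simps)
  qed
  show ode: ?ode unfolding ode_sol_on_def
    by (intro exI[of _ "\<lambda>x. \<epsilon>\<^sup>2 * uh x - uh x powr (2 * k + 1)"])
      (intro ballI conjI d1 d2, simp add: add.commute)
  have cont: "continuous_on S uh" "continuous_on S duh" for S
    by (rule DERIV_continuous_on, rule d1) (rule DERIV_continuous_on, rule d2)
  have s_le: "?s x \<le> 4 * exp (- \<epsilon> * x)" if "0 \<le> x" for x
  proof -
    have "2 powr (1 / k) \<le> 2 powr (1::real)" using k by (intro powr_mono) auto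
    then have "soliton k 0 * 2 powr (1 / k) \<le> 2 * 2"
      using soliton_0_bounds[OF k] by (intro mult_mono) auto
    then have "soliton k 0 * 2 powr (1 / k) * exp (- (\<epsilon> * x + a)) \<le> 4 * exp (- (\<epsilon> * x + a))" by simp
    also have "\<dots> \<le> 4 * exp (- \<epsilon> * x)" using a by simp
    finally show ?thesis using soliton_le[OF k0, of "\<epsilon> * x + a"] by linarith
  qed
  have sq: "(?s x)\<^sup>2 \<le> 16 * exp (- (2 * \<epsilon>) * x)" if "0 \<le> x" for x
  proof -
    have "(?s x)\<^sup>2 \<le> (4 * exp (- \<epsilon> * x))\<^sup>2"
      using s_le[OF that] soliton_pos[OF k0, of "\<epsilon> * x + a"] by (intro power_mono) auto
    also have "\<dots> = 16 * exp (- (2 * \<epsilon>) * x)"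
      by (simp add: power_mult_distrib power2_eq_square exp_add[symmetric])
    finally show ?thesis .
  qed
  have t1: "(?t x)\<^sup>2 \<le> 1" for x
    using tanh_real_bounds[of "k * (\<epsilon> * x + a)"] by (simp add: abs_square_le_1 abs_le_iff)
  have uh2: "(uh x)\<^sup>2 \<le> 16 * c\<^sup>2 * exp (- (2 * \<epsilon>) * x)" if "0 \<le> x" for x
    using mult_left_mono[OF sq[OF that], of "c\<^sup>2"] by (simp add: uh_def power_mult_distrib ac_simps)
  show "set_integrable lborel {0..} (\<lambda>x. (uh x)\<^sup>2)"
    using \<epsilon> uh2 by (intro set_integrable_exp_decay(1)[of "2 * \<epsilon>" _ "16 * c\<^sup>2"])
      (auto intro!: continuous_intros cont)
  have duh2: "(duh x)\<^sup>2 \<le> 16 * c\<^sup>2 * exp (- (2 * \<epsilon>) * x)" if "0 \<le> x" for x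
  proof -
    have "(duh x)\<^sup>2 = (uh x)\<^sup>2 * (\<epsilon>\<^sup>2 * (?t x)\<^sup>2)"
      by (simp add: duh_def uh_def power_mult_distrib)
    also have "\<dots> \<le> (uh x)\<^sup>2 * 1"
      using t1[of x] \<epsilon> by (intro mult_left_mono mult_le_one) (auto simp: power_le_one)
    finally show ?thesis using uh2[OF that] by simp
  qed
  show int_du: ?int
    using \<epsilon> duh2 by (intro set_integrable_exp_decay(1)[of "2 * \<epsilon>" _ "16 * c\<^sup>2"])
      (auto intro!: continuous_intros cont)
  \<comment> \<open>Here \<open>56 = 7/2 * 16\<close>: two powers of the soliton decay with factor
    16, the other \<open>2 k\<close> are at most \<open>k + 1 \<le> 7/2\<close>. Integration divides
    by \<open>2 \<epsilon>\<close> and yields the constant 28.\<close>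
  have up: "\<bar>uh x\<bar> powr (2 * k + 2) \<le> 56 * c\<^sup>2 * \<epsilon>\<^sup>2 * exp (- (2 * \<epsilon>) * x)" if "0 \<le> x" for x
  proof -
    have "\<bar>uh x\<bar> powr (2 * k + 2) = c\<^sup>2 * \<epsilon>\<^sup>2 * (?s x powr (2 * k) * (?s x)\<^sup>2)"
      using c soliton_pos[OF k0, of "\<epsilon> * x + a"]
      by (simp add: uh_def abs_mult powr_mult less_imp_le powr_c powr_add[of "soliton _ _"] powr_numeral)
    also have "?s x powr (2 * k) \<le> 7 / 2 * 1"
      unfolding soliton_powr[OF k0] using k t1[of x] by (intro mult_mono) auto
    also have "(7 / 2 * 1) * (?s x)\<^sup>2 \<le> 7 / 2 * (16 * exp (- (2 * \<epsilon>) * x))"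
      using sq[OF that] by simp
    finally show ?thesis by (simp add: mult_left_mono mult_right_mono algebra_simps)
  qed
  have cp: "continuous_on {0..} (\<lambda>x. \<bar>uh x\<bar> powr (2 * k + 2))"
    using cont pos by (intro continuous_intros) (auto, metis less_irrefl)
  have int_p: "set_integrable lborel {0..} (\<lambda>x. \<bar>uh x\<bar> powr (2 * k + 2))"
    "(LBINT x:{0..}. \<bar>uh x\<bar> powr (2 * k + 2)) \<le> 56 * c\<^sup>2 * \<epsilon>\<^sup>2 / (2 * \<epsilon>)"
    using \<epsilon> up by (intro set_integrable_exp_decay[of "2 * \<epsilon>" _ "56 * c\<^sup>2 * \<epsilon>\<^sup>2"] cp; auto)+
  have "56 * c\<^sup>2 * \<epsilon>\<^sup>2 / (2 * \<epsilon>) = 28 * c\<^sup>2 * \<epsilon>" using \<epsilon> by (simp add: power2_eq_square)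
  also have "\<dots> \<le> 28 * c\<^sup>2 * 1" using \<epsilon> by (intro mult_left_mono) auto
  finally show "(LBINT x:{0..}. \<bar>uh x\<bar> powr (2 * k + 2)) \<le> 28 * c\<^sup>2" using int_p(2) by linarith
  have ham: "(duh 0)\<^sup>2 / 2 + uh 0 powr (2 * k + 2) / (2 * k + 2) - \<epsilon>\<^sup>2 * (uh 0)\<^sup>2 / 2 = 0"
  proof -
    have "uh 0 powr (2 * k + 2) = c\<^sup>2 * \<epsilon>\<^sup>2 * soliton k a powr (2 * k + 2)"
      using c soliton_pos[OF k0, of a] by (simp add: uh_def powr_mult less_imp_le powr_c)
    then have "uh 0 powr (2 * k + 2) / (2 * k + 2) - \<epsilon>\<^sup>2 * (uh 0)\<^sup>2 / 2
       = c\<^sup>2 * \<epsilon>\<^sup>2 * (soliton k a powr (2 * k + 2) / (2 * k + 2) - (soliton k a)\<^sup>2 / 2)"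
      by (simp add: uh_def power_mult_distrib algebra_simps)
    also have "\<dots> = - (duh 0)\<^sup>2 / 2"
      unfolding soliton_hamiltonian[OF k0] by (simp add: duh_def power_mult_distrib)
    finally show ?thesis by linarith
  qed
  have lim: "((\<lambda>x. uh x * duh x) \<longlongrightarrow> 0) at_top"
  proof (rule Lim_null_comparison)
    show "\<forall>\<^sub>F x in at_top. norm (uh x * duh x) \<le> 16 * c\<^sup>2 * exp (- (2 * \<epsilon>) * x)"
      using eventually_ge_at_top[of 0]
    proof eventually_elim
      case (elim x)
      have "\<bar>uh x * duh x\<bar> \<le> ((uh x)\<^sup>2 + (duh x)\<^sup>2) / 2"
        using zero_le_power2[of "uh x - duh x"] zero_le_power2[of "uh x + duh x"]
        by (simp add: abs_le_iff power2_eq_square algebra_simps)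
      then show ?case using uh2[OF elim] duh2[OF elim] by simp
    qed
    show "((\<lambda>x. 16 * c\<^sup>2 * exp (- (2 * \<epsilon>) * x)) \<longlongrightarrow> 0) at_top" using \<epsilon> by real_asymp
  qed
  show "1 / 2 * (LBINT x:{0..}. (duh x)\<^sup>2) - 1 / (2 * k + 2) * (LBINT x:{0..}. \<bar>uh x\<bar> powr (2 * k + 2))
     = - (uh 0 * duh 0) / 4 + (2 * k + 2 - 6) / (4 * (2 * k + 2)) * (LBINT x:{0..}. \<bar>uh x\<bar> powr (2 * k + 2))"
    using k0 by (intro ode_energy_half_line[OF ode _ pos ham int_du int_p(1) lim]) auto
qed

section \<open>Solutions of small frequency\<close>

lemma nonlin_deriv:
  "0 < x \<Longrightarrow> (nonlin k has_real_derivative (2 * k + 1) * x powr (2 * k) - 1) (at x within S)"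
  unfolding nonlin_def[abs_def]
  using DERIV_diff[OF has_real_derivative_powr[of x "2 * k + 1"] DERIV_ident]
  by (auto intro: has_field_derivative_at_within)

text \<open>On this range the derivative is at most \<open>6 * 3^5 + 1 = 1459\<close> in absolute
  value. The interval away from 0 is where the core solutions will be kept.\<close>

lemma nonlin_lipschitz:
  assumes k: "2 \<le> k" "k \<le> 5 / 2" and "x \<in> {1/4..3}" "y \<in> {1/4..3}"
  shows "\<bar>nonlin k x - nonlin k y\<bar> \<le> 1459 * \<bar>x - y\<bar>"
proof -
  have "\<bar>(2 * k + 1) * z powr (2 * k) - 1\<bar> \<le> 1459" if z: "z \<in> {1/4..3}" for z :: real
  proof -
    have "z powr (2 * k) \<le> 3 powr (2 * k)" using k z by (intro powr_mono2) auto
    also have "\<dots> \<le> 3 powr 5" using k by (intro powr_mono) auto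
    also have "\<dots> = 243" by (simp add: powr_numeral)
    finally have "(2 * k + 1) * z powr (2 * k) \<le> 6 * 243" using k by (intro mult_mono) auto
    moreover have "0 \<le> (2 * k + 1) * z powr (2 * k)" using k by simp
    ultimately show ?thesis by (simp add: abs_le_iff)
  qed
  then show ?thesis
    using field_differentiable_bound[of "{1/4..3}" "nonlin k" "\<lambda>z. (2 * k + 1) * z powr (2 * k) - 1" 1459 x y]
      nonlin_deriv assms by auto
qed

text \<open>The margin 1/12 above 1 equals the deviation later allowed on the core. Starting from
  the maximum, the solution then stays above 1, where \<open>nonlin\<close> is nonnegative.\<close>

lemma soliton_0_gt:
  assumes k: "2 \<le> k" "k \<le> 5 / 2"
  shows "13 / 12 \<le> soliton k 0"
proof -
  have "(13 / 12 :: real) powr (2 * k) \<le> (13 / 12) powr 5" using k by (intro powr_mono) auto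
  also have "\<dots> \<le> k + 1" using k by (simp add: powr_numeral power_divide)
  finally have "((13 / 12 :: real) powr (2 * k)) powr (1 / (2 * k)) \<le> (k + 1) powr (1 / (2 * k))"
    using k by (intro powr_mono2) auto
  then show ?thesis using k by (simp add: powr_powr soliton_0)
qed

text \<open>The constant is \<open>3^6 + 3\<close>.\<close>

lemma nonlin_bound:
  assumes k: "2 \<le> k" "k \<le> 5 / 2" and x: "x \<in> {1/4..3}"
  shows "\<bar>nonlin k x\<bar> \<le> 732"
proof -
  have "x powr (2 * k + 1) \<le> 3 powr (2 * k + 1)" using k x by (intro powr_mono2) auto
  also have "\<dots> \<le> 3 powr 6" using k by (intro powr_mono) auto
  also have "\<dots> = 729" by (simp add: powr_numeral)
  finally have "x powr (2 * k + 1) \<le> 729" .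
  moreover have "0 \<le> x powr (2 * k + 1)" "0 \<le> x" "x \<le> 3" using x by auto
  ultimately show ?thesis unfolding nonlin_def by linarith
qed

text \<open>Gives the change of potential between the junction value and a vertex value as the
  vertex displacement times \<open>nonlin\<close> at a nearby point, without a second-order
  expansion.\<close>

lemma nonlin_primitive_mean_value:
  assumes "0 < k" "0 < x" "0 < y"
  obtains \<xi> where "min x y \<le> \<xi>" "\<xi> \<le> max x y"
    "(y powr (2 * k + 2) / (2 * k + 2) - y\<^sup>2 / 2) - (x powr (2 * k + 2) / (2 * k + 2) - x\<^sup>2 / 2) = nonlin k \<xi> * (y - x)"
proof -
  define F where "F = (\<lambda>y::real. y powr (2 * k + 2) / (2 * k + 2) - y\<^sup>2 / 2)"
  have F: "(F has_real_derivative nonlin k z) (at z)" if "0 < z" for z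
  proof -
    have "((\<lambda>z. z powr (2 * k + 2)) has_real_derivative (2 * k + 2) * z powr (2 * k + 2 - 1)) (at z)"
      by (rule has_real_derivative_powr[OF that])
    from DERIV_cdivide[OF this, of "2 * k + 2"]
    have "((\<lambda>z. z powr (2 * k + 2) / (2 * k + 2)) has_real_derivative z powr (2 * k + 1)) (at z)"
      using assms(1) by (simp add: add.commute)
    moreover have "((\<lambda>z. z\<^sup>2 / 2) has_real_derivative z) (at z)"
      by (auto intro!: derivative_eq_intros)
    ultimately show ?thesis unfolding F_def nonlin_def by (rule DERIV_diff)
  qed
  consider "x < y" | "y < x" | "x = y" by linarith
  then show thesis
  proof cases
    case 1
    then obtain z where "x < z" "z < y" "F y - F x = (y - x) * nonlin k z"
      using MVT2[of x y F "nonlin k"] F assms by auto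
    then show thesis using 1 by (intro that[of z]) (auto simp: F_def mult.commute)
  next
    case 2
    then obtain z where "y < z" "z < x" "F x - F y = (x - y) * nonlin k z"
      using MVT2[of y x F "nonlin k"] F assms by auto
    then show thesis using 2 by (intro that[of z]) (auto simp: F_def algebra_simps)
  next
    case 3
    then show thesis by (intro that[of x]) auto
  qed
qed

context green_graph
begin

abbreviation total_len :: real where "total_len \<equiv> \<Sum>i<n. len i"

lemma edge_cont_const [simp]: "edge_cont (\<lambda>_ _. c)"
  by (simp add: edge_cont_def)

lemma src1_const: "0 \<le> x \<Longrightarrow> src1 (\<lambda>_ _. c) i x = c * x"
  by (simp add: src1_def)

lemma src1_zero: "src1 (\<lambda>_ _. 0) i x = 0"
  by (simp add: src1_def)

lemma src2_const: "0 \<le> x \<Longrightarrow> src2 (\<lambda>_ _. c) i x = c * x\<^sup>2 / 2"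
proof -
  assume x: "0 \<le> x"
  have "src2 (\<lambda>_ _. c) i x = integral {0..x} (\<lambda>t. c * t)"
    unfolding src2_def by (intro integral_cong) (simp add: src1_const)
  also have "\<dots> = c * (x\<^sup>2 / 2)"
    using ident_has_integral[OF x] by (simp add: integral_unique)
  finally show ?thesis by simp
qed

lemma D_const: "i < n \<Longrightarrow> D (\<lambda>_ _. c) i = c * D (\<lambda>_ _. 1) i"
proof -
  assume i: "i < n"
  have "D (\<lambda>_ _. c) i * len i = c * (D (\<lambda>_ _. 1) i * len i)"
    using Y_tgt[OF i, of "\<lambda>_ _. c"] Y_tgt[OF i, of "\<lambda>_ _. 1"] len_pos[OF i]
      Y_const[of c "src i"] Y_const[of c "tgt i"]
    by (simp add: src2_const less_imp_le algebra_simps)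
  then show ?thesis using len_pos[OF i] by simp
qed

lemma green_bound:
  assumes "edge_cont g" "\<And>i t. i < n \<Longrightarrow> t \<in> {0..len i} \<Longrightarrow> \<bar>g i t\<bar> \<le> \<beta>" "0 \<le> \<beta>" "i < n" "x \<in> {0..len i}"
  shows "\<bar>green g i x\<bar> \<le> C * \<beta>"
proof -
  have "Y (\<lambda>_ _. 0) (src i) = 0" "D (\<lambda>_ _. 0) i = 0" "src2 (\<lambda>_ _. 0) i x = 0"
    using Y_const[of 0] D_const[OF assms(4), of 0] assms(5) src2_const[of x 0 i] by auto
  then show ?thesis
    using green_diff[OF assms(1) edge_cont_const[of 0] _ assms(3-5)] assms(2)
    unfolding green_def by auto
qed

lemma sum_src1_diff:
  assumes "edge_cont g" "edge_cont h" "\<And>i t. i < n \<Longrightarrow> t \<in> {0..len i} \<Longrightarrow> \<bar>g i t - h i t\<bar> \<le> \<beta>"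
  shows "\<bar>(\<Sum>i<n. src1 g i (len i)) - (\<Sum>i<n. src1 h i (len i))\<bar> \<le> \<beta> * total_len"
  unfolding sum_subtractf[symmetric] sum_distrib_left
  by (intro order_trans[OF sum_abs] sum_mono src1_diff_bound assms)
    (auto simp: len_pos less_imp_le)

text \<open>Shooting in the shift \<open>a\<close> of the soliton. The three smallness conditions
  give, in order, the contraction, the confinement of \<open>V\<close> (deviation at most 1/12), and
  a core flux below the soliton slope at \<open>a = 1\<close>.\<close>

lemma core_solution:
  assumes k: "2 \<le> k" "k \<le> 5 / 2" and \<epsilon>: "0 < \<epsilon>" "\<epsilon> \<le> 1"
    and small: "\<epsilon> * (C * 1459) \<le> 1 / 2" "\<epsilon> * (732 * C) \<le> 1 / 12" "\<epsilon> * (732 * total_len) \<le> 1 / 6"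
  obtains a V g where "0 \<le> a" "a \<le> 1" "edge_cont V" "edge_cont g"
    "\<And>i x. i < n \<Longrightarrow> x \<in> {0..len i} \<Longrightarrow> V i x \<in> {1/4..3}"
    "\<And>i x. i < n \<Longrightarrow> x \<in> {0..len i} \<Longrightarrow> g i x = nonlin k (V i x)"
    "\<And>i x. i < n \<Longrightarrow> x \<in> {0..len i} \<Longrightarrow> V i x = soliton k a + \<epsilon>\<^sup>2 * green g i x"
    "\<And>i x. i < n \<Longrightarrow> x \<in> {0..len i} \<Longrightarrow> \<bar>V i x - soliton k a\<bar> \<le> \<epsilon> * (732 * C)"
    "soliton k a * tanh (k * a) = \<epsilon> * (\<Sum>i<n. src1 g i (len i))"
    "\<bar>soliton k a - soliton k 0\<bar> \<le> \<epsilon> * (4392 * total_len)"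
proof -
  have K0: "0 \<le> total_len" using len_pos by (intro sum_nonneg) (auto simp: less_imp_le)
  \<comment> \<open>The nonlinearity is truncated to be globally Lipschitz; the solution stays in \<open>[1/4, 3]\<close>.\<close>
  define f where "f = (\<lambda>y. nonlin k (max (1/4) (min 3 y)))"
  have f_lip: "\<bar>f x - f y\<bar> \<le> 1459 * \<bar>x - y\<bar>" for x y
  proof -
    have "\<bar>f x - f y\<bar> \<le> 1459 * \<bar>max (1/4) (min 3 x) - max (1/4) (min 3 y)\<bar>"
      unfolding f_def by (intro nonlin_lipschitz k) auto
    also have "\<dots> \<le> 1459 * \<bar>x - y\<bar>" by (intro mult_left_mono) auto
    finally show ?thesis .
  qed
  have f_bound: "\<bar>f x\<bar> \<le> 732" for x
    unfolding f_def by (intro nonlin_bound k) auto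
  have eps2: "\<epsilon>\<^sup>2 \<le> \<epsilon>" using \<epsilon> by (simp add: power2_eq_square mult_left_le)
  have "\<epsilon>\<^sup>2 * C * 1459 \<le> \<epsilon> * (C * 1459)"
    using mult_right_mono[OF eps2, of "C * 1459"] C_pos by (simp add: mult.assoc)
  then have "\<epsilon>\<^sup>2 * C * 1459 \<le> 1 / 2" using small(1) by linarith
  then obtain V where V_cont: "\<And>s. edge_cont (V s)"
    and V: "\<And>s i x. \<lbrakk>i < n; x \<in> {0..len i}\<rbrakk> \<Longrightarrow> V s i x = s + \<epsilon>\<^sup>2 * green (\<lambda>i x. f (V s i x)) i x"
    and V_lip: "\<And>s s' i x. \<bar>V s i x - V s' i x\<bar> \<le> 2 * \<bar>s - s'\<bar>"
    using semilinear_solution[of f 1459 "\<epsilon>\<^sup>2"] f_lip by auto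
  define g where "g = (\<lambda>s i x. f (V s i x))"
  have f_cont: "continuous_on UNIV f"
    by (rule lipschitz_on_continuous_on[of 1459]) (auto intro!: lipschitz_onI simp: dist_real_def f_lip)
  have g_cont: "edge_cont (g s)" for s
    unfolding g_def by (rule edge_cont_compose[OF V_cont f_cont])
  have V_near: "\<bar>V s i x - s\<bar> \<le> \<epsilon> * (732 * C)" if "i < n" "x \<in> {0..len i}" for s i x
  proof -
    have "\<bar>green (g s) i x\<bar> \<le> C * 732"
      using that by (intro green_bound g_cont) (auto simp: g_def f_bound)
    then have "\<epsilon>\<^sup>2 * \<bar>green (g s) i x\<bar> \<le> \<epsilon> * (732 * C)"
      using eps2 \<epsilon> by (intro mult_mono) auto
    then show ?thesis using V[OF that, of s] by (simp add: g_def abs_mult)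
  qed
  define S where "S = (\<lambda>s. \<Sum>i<n. src1 (g s) i (len i))"
  have S_lip: "\<bar>S s - S s'\<bar> \<le> 2918 * total_len * \<bar>s - s'\<bar>" for s s'
  proof -
    have "\<bar>g s i x - g s' i x\<bar> \<le> 2918 * \<bar>s - s'\<bar>" for i x
      using order_trans[OF f_lip mult_left_mono[OF V_lip]] by (simp add: g_def)
    from sum_src1_diff[OF g_cont g_cont this] show ?thesis by (simp add: S_def ac_simps)
  qed
  have S_cont: "continuous_on UNIV S"
    using S_lip K0
    by (intro lipschitz_on_continuous_on[of "2918 * total_len"] lipschitz_onI) (auto simp: dist_real_def)
  have S_bound: "\<bar>S s\<bar> \<le> 732 * total_len" for s
    using sum_src1_diff[OF g_cont edge_cont_const[of 0], of s 732] f_bound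
    by (simp add: S_def g_def src1_zero)
  \<comment> \<open>At \<open>s\<close> equal to the maximum of the soliton, \<open>V\<close> is at
    least \<open>13/12 - 1/12 = 1\<close> on the whole core, so the source is nonnegative.\<close>
  have S0: "0 \<le> S (soliton k 0)"
  proof -
    let ?m = "soliton k 0"
    have "0 \<le> g ?m i x" if "i < n" "x \<in> {0..len i}" for i x
    proof -
      have "1 \<le> V ?m i x"
        using V_near[OF that, of ?m] small(2) soliton_0_gt[OF k] by linarith
      then have "1 \<le> max (1/4) (min 3 (V ?m i x))" by simp
      then have "max (1/4) (min 3 (V ?m i x)) powr 1 \<le> max (1/4) (min 3 (V ?m i x)) powr (2 * k + 1)"
        using k by (intro powr_mono) auto
      then show ?thesis by (simp add: g_def f_def nonlin_def)
    qed
    then show ?thesis unfolding S_def src1_def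
      using g_cont[of ?m]
      by (intro sum_nonneg integral_nonneg integrable_continuous_real) (auto simp: edge_cont_def)
  qed
  \<comment> \<open>Defect of Kirchhoff's condition at the root after scaling: soliton slope minus
    flux out of the core. It is at most 0 at \<open>a = 0\<close>, where the soliton is flat, and at
    least 0 at \<open>a = 1\<close>.\<close>
  define \<Psi> where "\<Psi> = (\<lambda>a. soliton k a * tanh (k * a) - \<epsilon> * S (soliton k a))"
  have sol_cont: "continuous_on {0..1} (soliton k)"
    by (rule DERIV_continuous_on) (rule has_field_derivative_at_within, rule soliton_deriv, use k in simp)
  have \<Psi>_cont: "continuous_on {0..1} \<Psi>"
    unfolding \<Psi>_def
    by (intro continuous_intros sol_cont continuous_on_compose2[OF S_cont sol_cont]) auto
  have "\<Psi> 0 \<le> 0" using S0 \<epsilon> by (simp add: \<Psi>_def)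
  moreover have eS: "\<epsilon> * S s \<le> \<epsilon> * (732 * total_len)" for s
    using S_bound[of s] \<epsilon> by (intro mult_left_mono) auto
  have "0 \<le> \<Psi> 1" using soliton_slope_ge[OF k] eS[of "soliton k 1"] small(3) by (simp add: \<Psi>_def)
  ultimately obtain a where a: "0 \<le> a" "a \<le> 1" "\<Psi> a = 0"
    using IVT'[of \<Psi> 0 0 1] \<Psi>_cont by auto
  define s where "s = soliton k a"
  have match: "s * tanh (k * a) = \<epsilon> * S s" using a(3) by (simp add: \<Psi>_def s_def)
  have s13: "1 / 3 \<le> s" unfolding s_def using soliton_nonneg_ge_third[OF k a(1,2)] .
  have s2: "s \<le> 2" unfolding s_def
    using soliton_le_max[of k a] soliton_0_bounds[OF k] k by linarith
  have tanh0: "0 \<le> tanh (k * a)" using k a by simp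
  \<comment> \<open>Dividing the matched slope by \<open>s \<ge> 1/3\<close> turns 732 into
    \<open>2196 = 3 * 732\<close>; the drop estimate doubles it to 4392.\<close>
  have "1 / 3 * tanh (k * a) \<le> s * tanh (k * a)" using s13 tanh0 by (rule mult_right_mono)
  then have "tanh (k * a) \<le> \<epsilon> * (2196 * total_len)" using match eS[of s] by simp
  then have drop: "\<bar>s - soliton k 0\<bar> \<le> \<epsilon> * (4392 * total_len)"
    using soliton_drop_le[OF k a(1,2)] soliton_le_max[of k a] k by (simp add: s_def)
  \<comment> \<open>\<open>1/3 - 1/12 = 1/4\<close> and \<open>2 + 1/12 < 3\<close>, so the
    truncation is inactive and \<open>V\<close> solves the original equation.\<close>
  have V_range: "V s i x \<in> {1/4..3}" if "i < n" "x \<in> {0..len i}" for i x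
    using V_near[OF that, of s] small(2) s13 s2 by auto
  show thesis
  proof (rule that[OF a(1,2) V_cont[of s] g_cont[of s]])
    show "V s i x \<in> {1/4..3}" if "i < n" "x \<in> {0..len i}" for i x
      by (rule V_range[OF that])
    show "g s i x = nonlin k (V s i x)" if "i < n" "x \<in> {0..len i}" for i x
    proof -
      have "max (1/4) (min 3 (V s i x)) = V s i x" using V_range[OF that] by auto
      then show ?thesis by (simp add: g_def f_def)
    qed
    show "V s i x = soliton k a + \<epsilon>\<^sup>2 * green (g s) i x" if "i < n" "x \<in> {0..len i}" for i x
      using V[OF that, of s] by (simp add: g_def s_def)
    show "\<bar>V s i x - soliton k a\<bar> \<le> \<epsilon> * (732 * C)" if "i < n" "x \<in> {0..len i}" for i x
      using V_near[OF that, of s] by (simp add: s_def)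
    show "soliton k a * tanh (k * a) = \<epsilon> * (\<Sum>i<n. src1 (g s) i (len i))"
      using match by (simp add: s_def S_def)
    show "\<bar>soliton k a - soliton k 0\<bar> \<le> \<epsilon> * (4392 * total_len)"
      using drop by (simp add: s_def)
  qed
qed

end

text \<open>Compares the conserved quantity on an edge with its leading part, in which the source is
  the constant \<open>f\<close>. The errors linear in the data of the unit problem cost
  \<open>5 * N * e\<close> each, three times; the rest fits into \<open>7 * e\<close>, and the
  square of the error of \<open>S\<close> has a favourable sign.\<close>

lemma perturbed_density_le:
  fixes d y S \<phi> :: real
  assumes e: "0 \<le> e" "e \<le> 1" and f: "0 \<le> f" "f \<le> 5"
    and d: "\<bar>d - f * d1\<bar> \<le> e" and y: "\<bar>y - f * y1\<bar> \<le> e" and S: "\<bar>S - f * K\<bar> \<le> e" and \<phi>: "\<bar>\<phi> - f\<bar> \<le> e"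
    and N: "\<bar>d1\<bar> \<le> N" "\<bar>y1\<bar> \<le> N" "\<bar>K\<bar> \<le> N"
  shows "d\<^sup>2 / 2 + \<phi> * y - S\<^sup>2 / 2 \<le> f\<^sup>2 * (d1\<^sup>2 / 2 + y1 - K\<^sup>2 / 2) + e * (15 * N + 7)"
proof -
  define \<alpha> \<gamma> \<sigma> \<beta> where "\<alpha> = d - f * d1" and "\<gamma> = y - f * y1" and "\<sigma> = S - f * K" and "\<beta> = \<phi> - f"
  have N0: "0 \<le> N" using N(1) by linarith
  have triple: "\<bar>f * x * z\<bar> \<le> 5 * N * e" if "\<bar>x\<bar> \<le> N" "\<bar>z\<bar> \<le> e" for x z
    using f e N0 that unfolding abs_mult by (intro mult_mono) auto
  have 1: "f * d1 * \<alpha> \<le> 5 * N * e" "f * y1 * \<beta> \<le> 5 * N * e" "- (f * K * \<sigma>) \<le> 5 * N * e"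
    using triple[of d1 \<alpha>] triple[of y1 \<beta>] triple[of K \<sigma>] d y S \<phi> N
    by (auto simp: \<alpha>_def \<beta>_def \<sigma>_def abs_le_iff)
  have "\<bar>\<alpha>\<bar> * \<bar>\<alpha>\<bar> \<le> e * 1" using d e by (intro mult_mono) (auto simp: \<alpha>_def)
  then have 2: "\<alpha>\<^sup>2 \<le> e" by (simp add: power2_eq_square abs_mult[symmetric])
  have "\<bar>\<beta> * \<gamma>\<bar> \<le> e * 1" unfolding abs_mult using \<phi> y e by (intro mult_mono) (auto simp: \<beta>_def \<gamma>_def)
  then have 3: "\<beta> * \<gamma> \<le> e" by linarith
  have "\<bar>f * \<gamma>\<bar> \<le> 5 * e" unfolding abs_mult using f y e by (intro mult_mono) (auto simp: \<gamma>_def)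
  then have 4: "f * \<gamma> \<le> 5 * e" by linarith
  have "d\<^sup>2 / 2 + \<phi> * y - S\<^sup>2 / 2 = f\<^sup>2 * (d1\<^sup>2 / 2 + y1 - K\<^sup>2 / 2)
      + f * d1 * \<alpha> + \<alpha>\<^sup>2 / 2 + f * \<gamma> + f * y1 * \<beta> + \<beta> * \<gamma> - f * K * \<sigma> - \<sigma>\<^sup>2 / 2"
    by (simp add: \<alpha>_def \<beta>_def \<gamma>_def \<sigma>_def power2_eq_square field_simps)
  also have "\<dots> \<le> f\<^sup>2 * (d1\<^sup>2 / 2 + y1 - K\<^sup>2 / 2) + e * (15 * N + 7)"
  proof -
    have "0 \<le> \<sigma>\<^sup>2" by simp
    moreover have "e * (15 * N + 7) = 3 * (5 * N * e) + 7 * e" by (simp add: algebra_simps)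
    ultimately show ?thesis using 1 2 3 4 e by linarith
  qed
  finally show ?thesis .
qed

definition (in rooted_graph) has_negative_energy_solution :: "real \<Rightarrow> bool" where
  "has_negative_energy_solution k \<longleftrightarrow> (\<exists>u du uh duh lam (phi :: nat \<Rightarrow> real).
     (\<forall>i<n. ode_sol_on {0..len i} (2 * k + 2) lam (u i) (du i)) \<and> ode_sol_on {0..} (2 * k + 2) lam uh duh
   \<and> (\<forall>i<n. \<forall>x\<in>{0..len i}. 0 < u i x) \<and> (\<forall>x\<ge>0. 0 < uh x)
   \<and> (\<forall>i<n. u i 0 = phi (src i) \<and> u i (len i) = phi (tgt i)) \<and> uh 0 = phi r
   \<and> set_integrable lborel {0..} (\<lambda>x. (uh x)\<^sup>2) \<and> set_integrable lborel {0..} (\<lambda>x. (duh x)\<^sup>2)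
   \<and> (\<forall>v. flux (\<lambda>i. du i 0) (\<lambda>i. - du i (len i)) v + (if v = r then duh 0 else 0) = 0)
   \<and> 1 / 2 * ((\<Sum>i<n. LBINT x:{0..len i}. (du i x)\<^sup>2) + (LBINT x:{0..}. (duh x)\<^sup>2))
      - 1 / (2 * k + 2) * ((\<Sum>i<n. LBINT x:{0..len i}. \<bar>u i x\<bar> powr (2 * k + 2))
           + (LBINT x:{0..}. \<bar>uh x\<bar> powr (2 * k + 2))) < 0)"

context green_graph
begin

text \<open>The hypothesis is \<open>3 T < K^3\<close> divided by 2, with \<open>T\<close> the
  torsional rigidity. The frequency depends on the gap alone and the graph constants, and
  \<open>\<eta>\<close> depends on that frequency, so one choice serves every admissible
  \<open>k\<close>.\<close>

lemma negative_energy_solution: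
  assumes gap: "(\<Sum>i<n. len i * ((D (\<lambda>_ _. 1) i)\<^sup>2 / 2 + Y (\<lambda>_ _. 1) (src i))) < total_len ^ 3 / 2"
  obtains \<eta> where "0 < \<eta>" "\<And>k. 2 \<le> k \<Longrightarrow> k \<le> 2 + \<eta> \<Longrightarrow> has_negative_energy_solution k"
proof -
  let ?one = "\<lambda>_ _. 1 :: real"
  let ?K = total_len
  have K0: "0 \<le> ?K" using len_pos by (intro sum_nonneg) (auto simp: less_imp_le)
  define N where "N = 1 + ?K + (\<Sum>i<n. \<bar>D ?one i\<bar> + \<bar>Y ?one (src i)\<bar>)"
  have N1: "1 \<le> N" "?K \<le> N" using K0 by (auto simp: N_def intro!: add_nonneg_nonneg sum_nonneg)
  have N2: "\<bar>D ?one i\<bar> \<le> N" "\<bar>Y ?one (src i)\<bar> \<le> N" if "i < n" for i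
  proof -
    have "\<bar>D ?one i\<bar> + \<bar>Y ?one (src i)\<bar> \<le> (\<Sum>i<n. \<bar>D ?one i\<bar> + \<bar>Y ?one (src i)\<bar>)"
      using that by (intro member_le_sum[where f = "\<lambda>i. \<bar>D ?one i\<bar> + \<bar>Y ?one (src i)\<bar>"]) auto
    then show "\<bar>D ?one i\<bar> \<le> N" "\<bar>Y ?one (src i)\<bar> \<le> N" using K0 by (auto simp: N_def)
  qed
  define G where "G = ?K ^ 3 / 2 - (\<Sum>i<n. len i * ((D ?one i)\<^sup>2 / 2 + Y ?one (src i)))"
  have G0: "0 < G" using gap by (simp add: G_def)
  \<comment> \<open>\<open>\<epsilon> * B\<close> bounds the distance of the core solution from the
    soliton maximum: \<open>732 * C\<close> for \<open>V\<close> against \<open>s\<close>,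
    \<open>4392 * ?K\<close> for \<open>s\<close> against the maximum. \<open>Q\<close> then
    propagates this through \<open>nonlin\<close> (1459) to slopes and vertex values
    (\<open>C\<close>), total flux (\<open>?K\<close>) and the source itself (1).\<close>
  define B where "B = 732 * C + 4392 * ?K"
  have B0: "0 \<le> B" using C_pos K0 by (simp add: B_def)
  define Q where "Q = 1459 * B * (C + ?K + 1)"
  have Q0: "0 \<le> Q" using C_pos K0 B0 by (simp add: Q_def)
  \<comment> \<open>Chosen so that \<open>\<epsilon> * R \<le> 1\<close> makes the total error at
    most \<open>2 * G\<close>, half of the guaranteed gain \<open>4 * G\<close>.\<close>
  define R where "R = N * (15 * N + 7) * Q / (2 * G)"
  have R0: "0 \<le> R" using N1 Q0 G0 by (simp add: R_def)
  \<comment> \<open>The denominator adds up all requirements: \<open>8784 = 12 * 732\<close> also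
    covers \<open>2 * 1459\<close>, and \<open>4392 = 6 * 732\<close>.\<close>
  define \<epsilon> where "\<epsilon> = 1 / (1 + 8784 * C + 4392 * ?K + Q + R)"
  have den: "1 \<le> 1 + 8784 * C + 4392 * ?K + Q + R" using C_pos K0 Q0 R0 by simp
  have \<epsilon>: "0 < \<epsilon>" "\<epsilon> \<le> 1" using den by (auto simp: \<epsilon>_def)
  have \<epsilon>_le: "\<epsilon> * x \<le> 1" if "x \<le> 1 + 8784 * C + 4392 * ?K + Q + R" for x
    using that den by (simp add: \<epsilon>_def)
  have small: "\<epsilon> * (C * 1459) \<le> 1 / 2" "\<epsilon> * (732 * C) \<le> 1 / 12" "\<epsilon> * (732 * ?K) \<le> 1 / 6"
    "\<epsilon> * Q \<le> 1" "\<epsilon> * R \<le> 1"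
    using \<epsilon>_le[of "2 * (C * 1459)"] \<epsilon>_le[of "12 * (732 * C)"] \<epsilon>_le[of "6 * (732 * ?K)"] \<epsilon>_le[of Q] \<epsilon>_le[of R]
      C_pos K0 Q0 R0 by auto
  \<comment> \<open>The \<open>(p - 6)\<close> term is at most \<open>\<eta>\<close> times
    \<open>2187 * ?K + 28\<close>, and the gain is \<open>\<epsilon> ^ 4 * G\<close>, both up to
    \<open>c^2\<close>. The factor 2 makes the comparison strict.\<close>
  define \<eta> where "\<eta> = min (1 / 2) (\<epsilon> ^ 4 * G / (2 * (2187 * ?K + 28)))"
  have \<eta>: "0 < \<eta>" using \<epsilon> G0 K0 by (auto simp: \<eta>_def)
  have \<eta>_half: "\<eta> \<le> 1 / 2" unfolding \<eta>_def by (rule min.cobounded1)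
  have \<eta>_small: "\<eta> * (2187 * ?K + 28) < \<epsilon> ^ 4 * G"
  proof -
    have "\<eta> * (2187 * ?K + 28) \<le> \<epsilon> ^ 4 * G / (2 * (2187 * ?K + 28)) * (2187 * ?K + 28)"
      using K0 by (intro mult_right_mono) (auto simp: \<eta>_def)
    also have "\<dots> = \<epsilon> ^ 4 * G / 2" using K0 by (simp add: field_simps)
    also have "\<dots> < \<epsilon> ^ 4 * G" using \<epsilon> G0 by simp
    finally show ?thesis .
  qed
  show thesis
  proof (rule that[OF \<eta>])
    fix k :: real assume k2: "2 \<le> k" and k\<eta>: "k \<le> 2 + \<eta>"
    have k: "2 \<le> k" "k \<le> 5 / 2" using k2 k\<eta> \<eta>_half by auto
    then have k0: "0 < k" by simp
    obtain a V g where a: "0 \<le> a" "a \<le> 1" and cont: "edge_cont V" "edge_cont g"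
      and V_range: "\<And>i x. i < n \<Longrightarrow> x \<in> {0..len i} \<Longrightarrow> V i x \<in> {1/4..3}"
      and g: "\<And>i x. i < n \<Longrightarrow> x \<in> {0..len i} \<Longrightarrow> g i x = nonlin k (V i x)"
      and V: "\<And>i x. i < n \<Longrightarrow> x \<in> {0..len i} \<Longrightarrow> V i x = soliton k a + \<epsilon>\<^sup>2 * green g i x"
      and V_near: "\<And>i x. i < n \<Longrightarrow> x \<in> {0..len i} \<Longrightarrow> \<bar>V i x - soliton k a\<bar> \<le> \<epsilon> * (732 * C)"
      and match: "soliton k a * tanh (k * a) = \<epsilon> * (\<Sum>i<n. src1 g i (len i))"
      and drop: "\<bar>soliton k a - soliton k 0\<bar> \<le> \<epsilon> * (4392 * ?K)"
      by (rule core_solution[OF k \<epsilon> small(1-3)]) (rule that; assumption)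
    define s S m f where "s = soliton k a" and "S = (\<Sum>i<n. src1 g i (len i))"
      and "m = soliton k 0" and "f = nonlin k m"
    have m: "1 \<le> m" "m \<le> 2" unfolding m_def by (rule soliton_0_bounds[OF k])+
    have fm: "f = k * m" unfolding f_def m_def by (rule nonlin_soliton_0[OF k(1)])
    have f: "2 \<le> f" "f \<le> 5"
      unfolding fm using mult_mono[of 2 k 1 m] mult_mono[of k "5/2" m 2] k m by auto
    have s_range: "s \<in> {1/4..3}" "0 < s"
      using soliton_nonneg_ge_third[OF k a] soliton_le_max[OF k0, of a] m by (auto simp: s_def m_def)
    have nonlin_near: "\<bar>nonlin k z - f\<bar> \<le> \<epsilon> * (1459 * B)"
      if "z \<in> {1/4..3}" "\<bar>z - s\<bar> \<le> \<epsilon> * (732 * C)" for z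
    proof -
      have "\<bar>z - m\<bar> \<le> \<epsilon> * B"
        using that(2) drop unfolding B_def s_def m_def distrib_left by linarith
      moreover have "\<bar>nonlin k z - f\<bar> \<le> 1459 * \<bar>z - m\<bar>"
        unfolding f_def using m by (intro nonlin_lipschitz[OF k that(1)]) auto
      ultimately show ?thesis by simp
    qed
    have g_near: "\<bar>g i x - f\<bar> \<le> \<epsilon> * (1459 * B)" if "i < n" "x \<in> {0..len i}" for i x
      unfolding g[OF that] using V_range[OF that] V_near[OF that] by (intro nonlin_near) (auto simp: s_def)
    define e where "e = \<epsilon> * Q"
    have e: "0 \<le> e" "e \<le> 1" using \<epsilon> Q0 small(4) by (auto simp: e_def)
    have \<beta>0: "0 \<le> \<epsilon> * (1459 * B)" using \<epsilon> B0 by simp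
    have e_split: "e = C * (\<epsilon> * (1459 * B)) + ?K * (\<epsilon> * (1459 * B)) + \<epsilon> * (1459 * B)"
      by (simp add: e_def Q_def algebra_simps)
    have e_ge: "C * (\<epsilon> * (1459 * B)) \<le> e" "\<epsilon> * (1459 * B) * ?K \<le> e" "\<epsilon> * (1459 * B) \<le> e"
      using mult_nonneg_nonneg[OF K0 \<beta>0] mult_nonneg_nonneg[OF less_imp_le[OF C_pos] \<beta>0] \<beta>0
      unfolding e_split by (simp_all add: mult.commute)
    have D_near: "\<bar>D g i - f * D ?one i\<bar> \<le> e" if "i < n" for i
      using D_diff[OF cont(2) edge_cont_const[of f] g_near \<beta>0 that] e_ge(1) D_const[OF that, of f] by simp
    have Y_near: "\<bar>Y g (src i) - f * Y ?one (src i)\<bar> \<le> e" if "i < n" for i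
      using Y_diff[OF cont(2) edge_cont_const[of f] g_near \<beta>0 src_less[OF that]] e_ge(1) Y_const[of f] by simp
    have S_near: "\<bar>S - f * ?K\<bar> \<le> e"
    proof -
      have "(\<Sum>i<n. src1 (\<lambda>_ _. f) i (len i)) = f * ?K"
        unfolding sum_distrib_left by (intro sum.cong refl src1_const) (simp add: len_pos less_imp_le)
      then show ?thesis
        using sum_src1_diff[OF cont(2) edge_cont_const[of f] g_near] e_ge(2) by (simp add: S_def)
    qed

    \<comment> \<open>Amplitude for which \<open>c * V\<close> solves the equation with frequency
      \<open>\<epsilon>^2\<close>. Lengths are not rescaled on the core, hence the factor
      \<open>\<epsilon>^2\<close> in front of \<open>green\<close>, while the soliton is stretched
      on the half-line.\<close>
    define c where "c = \<epsilon> powr (1 / k)"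
    have c: "0 < c" "c powr (2 * k) = \<epsilon>\<^sup>2" using \<epsilon> k0 by (auto simp: c_def powr_powr powr_numeral)
    have powr_c: "c powr (2 * k + 1) = c * \<epsilon>\<^sup>2" "c powr (2 * k + 2) = c\<^sup>2 * \<epsilon>\<^sup>2"
      using c by (simp_all add: powr_add powr_numeral)
    define u where "u = (\<lambda>i x. c * (s + \<epsilon>\<^sup>2 * green g i x))"
    define du where "du = (\<lambda>i x. c * \<epsilon>\<^sup>2 * (D g i - src1 g i x))"
    define uh where "uh = (\<lambda>x. c * soliton k (\<epsilon> * x + a))"
    define duh where "duh = (\<lambda>x. - (c * \<epsilon> * soliton k (\<epsilon> * x + a) * tanh (k * (\<epsilon> * x + a))))"
    define phi where "phi = (\<lambda>v. c * (s + \<epsilon>\<^sup>2 * Y g v))"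
    note half_line = scaled_soliton[OF uh_def duh_def k \<epsilon> c a(1)]
    have uV: "u i x = c * V i x" if "i < n" "x \<in> {0..len i}" for i x
      using V[OF that] by (simp add: u_def s_def)
    have u_pos: "0 < u i x" if "i < n" "x \<in> {0..len i}" for i x
      using uV[OF that] V_range[OF that] c by simp
    have ode: "ode_sol_on {0..len i} (2 * k + 2) (\<epsilon>\<^sup>2) (u i) (du i)" if i: "i < n" for i
      unfolding ode_sol_on_def
    proof (intro exI[of _ "\<lambda>x. - (c * \<epsilon>\<^sup>2 * g i x)"] ballI conjI)
      fix x assume x: "x \<in> {0..len i}"
      show "(u i has_real_derivative du i x) (at x within {0..len i})"
        unfolding u_def du_def using green_deriv[OF cont(2) i x]
        by (auto intro!: derivative_eq_intros)
      show "(du i has_real_derivative - (c * \<epsilon>\<^sup>2 * g i x)) (at x within {0..len i})"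
        unfolding du_def using src1_deriv[OF cont(2) i x]
        by (auto intro!: derivative_eq_intros)
      have "u i x powr (2 * k + 1) = c * \<epsilon>\<^sup>2 * V i x powr (2 * k + 1)"
        using c V_range[OF i x] by (simp add: uV[OF i x] powr_mult powr_c)
      then show "- (c * \<epsilon>\<^sup>2 * g i x) + u i x powr (2 * k + 2 - 1) = \<epsilon>\<^sup>2 * u i x"
        by (simp add: uV[OF i x] g[OF i x] nonlin_def algebra_simps)
    qed
    have zero_mem: "0 \<in> {0..len i}" "len i \<in> {0..len i}" if "i < n" for i
      using len_pos[OF that] by auto
    have ends: "u i 0 = phi (src i)" "u i (len i) = phi (tgt i)"
      "du i 0 = c * \<epsilon>\<^sup>2 * D g i" "du i (len i) = - (c * \<epsilon>\<^sup>2) * (src1 g i (len i) - D g i)" if "i < n" for i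
    proof -
      have "green g i 0 = Y g (src i)" "green g i (len i) = Y g (tgt i)"
        using Y_tgt[OF that, of g] by (simp_all add: green_def src2_def)
      then show "u i 0 = phi (src i)" "u i (len i) = phi (tgt i)"
        "du i 0 = c * \<epsilon>\<^sup>2 * D g i" "du i (len i) = - (c * \<epsilon>\<^sup>2) * (src1 g i (len i) - D g i)"
        by (simp_all add: u_def phi_def du_def src1_def algebra_simps)
    qed
    have uh0: "uh 0 = phi r" by (simp add: uh_def phi_def Y_root s_def)
    have duh0: "duh 0 = - (c * \<epsilon>\<^sup>2 * S)"
      using match by (simp add: duh_def S_def power2_eq_square mult.assoc)
    have flux_scale: "flux (\<lambda>i. du i 0) (\<lambda>i. - du i (len i)) v
        = c * \<epsilon>\<^sup>2 * flux (D g) (\<lambda>i. src1 g i (len i) - D g i) v" for v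
      unfolding net_flux_def sum_distrib_left
      by (intro sum.cong refl) (auto simp: ends algebra_simps)
    have flux_r: "flux (D g) (\<lambda>i. src1 g i (len i) - D g i) r = S"
      using net_flux_root[of "{..<n}" r src tgt "D g" "\<lambda>i. src1 g i (len i) - D g i"] flux_D
      by (simp add: S_def)
    have kirchhoff: "flux (\<lambda>i. du i 0) (\<lambda>i. - du i (len i)) v + (if v = r then duh 0 else 0) = 0" for v
      using flux_D[of v g] by (simp add: flux_scale flux_r duh0)
    \<comment> \<open>Continuity and Kirchhoff's condition make the boundary terms
      \<open>u u'\<close> cancel at every vertex except the root; what remains there cancels the
      boundary term of the half-line.\<close>
    have boundary: "(\<Sum>i<n. u i (len i) * du i (len i) - u i 0 * du i 0) = uh 0 * duh 0"
    proof -
      have "(\<Sum>i<n. u i (len i) * du i (len i) - u i 0 * du i 0)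
          = - (\<Sum>i<n. phi (src i) * du i 0 + phi (tgt i) * - du i (len i))"
        unfolding sum_negf[symmetric] by (intro sum.cong refl) (simp add: ends)
      also have "\<dots> = - (\<Sum>v<nV. phi v * flux (\<lambda>i. du i 0) (\<lambda>i. - du i (len i)) v)"
        using src_less tgt_less by (subst sum_potential_net_flux[where S = "{..<nV}"]) auto
      also have "\<dots> = (\<Sum>v<nV. if v = r then phi v * duh 0 else 0)"
      proof -
        have "flux (\<lambda>i. du i 0) (\<lambda>i. - du i (len i)) v = (if v = r then - duh 0 else 0)" for v
          using kirchhoff[of v] by (cases "v = r") auto
        then show ?thesis unfolding sum_negf[symmetric] by (intro sum.cong refl) simp
      qed
      also have "\<dots> = uh 0 * duh 0" using root by (simp add: uh0)
      finally show ?thesis .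
    qed
    define h where "h = (\<lambda>i. (du i 0)\<^sup>2 / 2 + u i 0 powr (2 * k + 2) / (2 * k + 2) - \<epsilon>\<^sup>2 * (u i 0)\<^sup>2 / 2)"
    have h_le: "h i \<le> c\<^sup>2 * \<epsilon> ^ 4 * (f\<^sup>2 * ((D ?one i)\<^sup>2 / 2 + Y ?one (src i) - ?K\<^sup>2 / 2) + e * (15 * N + 7))"
      if i: "i < n" for i
    proof -
      let ?v = "V i 0"
      have v: "?v \<in> {1/4..3}" "?v = s + \<epsilon>\<^sup>2 * Y g (src i)" "\<bar>?v - s\<bar> \<le> \<epsilon> * (732 * C)"
        using V_range[OF i zero_mem(1)[OF i]] V[OF i zero_mem(1)[OF i]] V_near[OF i zero_mem(1)[OF i]]
        by (auto simp: s_def green_def src2_def)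
      then obtain \<xi> where \<xi>: "min s ?v \<le> \<xi>" "\<xi> \<le> max s ?v"
        "(?v powr (2 * k + 2) / (2 * k + 2) - ?v\<^sup>2 / 2) - (s powr (2 * k + 2) / (2 * k + 2) - s\<^sup>2 / 2) = nonlin k \<xi> * (?v - s)"
        using nonlin_primitive_mean_value[OF k0 s_range(2), of ?v] by auto
      have \<xi>_near: "\<bar>nonlin k \<xi> - f\<bar> \<le> e"
        using \<xi>(1,2) v(1,3) s_range(1) by (intro order_trans[OF nonlin_near e_ge(3)]) auto
      \<comment> \<open>Zero Hamiltonian together with the matched slope
        \<open>\<epsilon> * S\<close>: the potential at \<open>s\<close> is of order
        \<open>\<epsilon>^2\<close>, the same as its change over the core. This is the origin of the
        negative term \<open>- ?K^2 / 2\<close>.\<close>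
      have "s powr (2 * k + 2) / (2 * k + 2) - s\<^sup>2 / 2 = - (\<epsilon>\<^sup>2 * S\<^sup>2) / 2"
        unfolding s_def soliton_hamiltonian[OF k0] match by (simp add: S_def power_mult_distrib)
      then have prim: "?v powr (2 * k + 2) / (2 * k + 2) - ?v\<^sup>2 / 2 = \<epsilon>\<^sup>2 * (nonlin k \<xi> * Y g (src i) - S\<^sup>2 / 2)"
        using \<xi>(3) v(2) by (simp add: algebra_simps)
      have "u i 0 powr (2 * k + 2) = c\<^sup>2 * \<epsilon>\<^sup>2 * ?v powr (2 * k + 2)"
        using c v(1) by (simp add: uV[OF i zero_mem(1)[OF i]] powr_mult powr_c)
      then have "h i = c\<^sup>2 * \<epsilon> ^ 4 * (D g i)\<^sup>2 / 2 + c\<^sup>2 * \<epsilon>\<^sup>2 * (?v powr (2 * k + 2) / (2 * k + 2) - ?v\<^sup>2 / 2)"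
        unfolding h_def ends(3)[OF i] uV[OF i zero_mem(1)[OF i]]
        by (simp add: power_mult_distrib right_diff_distrib flip: power_mult)
      also have "\<dots> = c\<^sup>2 * \<epsilon> ^ 4 * ((D g i)\<^sup>2 / 2 + nonlin k \<xi> * Y g (src i) - S\<^sup>2 / 2)"
        unfolding prim by (simp add: power2_eq_square power4_eq_xxxx algebra_simps)
      also have "\<dots> \<le> c\<^sup>2 * \<epsilon> ^ 4 * (f\<^sup>2 * ((D ?one i)\<^sup>2 / 2 + Y ?one (src i) - ?K\<^sup>2 / 2) + e * (15 * N + 7))"
        using f K0 N1(2)
        by (intro mult_left_mono perturbed_density_le e D_near Y_near S_near \<xi>_near N2 i) auto
      finally show ?thesis .
    qed
    \<comment> \<open>From \<open>f \<ge> 2\<close> the gain is at least \<open>4 * G\<close>, and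
      the error uses up at most \<open>2 * G\<close> of it.\<close>
    have sum_h: "(\<Sum>i<n. h i * len i) \<le> - (2 * c\<^sup>2 * \<epsilon> ^ 4 * G)"
    proof -
      have "(\<Sum>i<n. h i * len i) \<le> (\<Sum>i<n. c\<^sup>2 * \<epsilon> ^ 4 * (f\<^sup>2 * (len i * ((D ?one i)\<^sup>2 / 2 + Y ?one (src i)))
           - f\<^sup>2 * (?K\<^sup>2 / 2) * len i + e * (15 * N + 7) * len i))"
      proof (intro sum_mono)
        fix i assume "i \<in> {..<n}"
        then have i: "i < n" by simp
        show "h i * len i \<le> c\<^sup>2 * \<epsilon> ^ 4 * (f\<^sup>2 * (len i * ((D ?one i)\<^sup>2 / 2 + Y ?one (src i)))
           - f\<^sup>2 * (?K\<^sup>2 / 2) * len i + e * (15 * N + 7) * len i)"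
          using mult_right_mono[OF h_le[OF i], of "len i"] len_pos[OF i]
          by (simp add: algebra_simps)
      qed
      also have "\<dots> = c\<^sup>2 * \<epsilon> ^ 4 * (f\<^sup>2 * (\<Sum>i<n. len i * ((D ?one i)\<^sup>2 / 2 + Y ?one (src i)))
           - f\<^sup>2 * (?K\<^sup>2 / 2) * ?K + e * (15 * N + 7) * ?K)"
        by (simp only: sum_distrib_left[symmetric] sum.distrib sum_subtractf)
      also have "\<dots> = c\<^sup>2 * \<epsilon> ^ 4 * (e * (15 * N + 7) * ?K - f\<^sup>2 * G)"
        by (simp add: G_def algebra_simps power2_eq_square power3_eq_cube)
      also have "\<dots> \<le> c\<^sup>2 * \<epsilon> ^ 4 * (- 2 * G)"
      proof (intro mult_left_mono)
        have "e * (15 * N + 7) * ?K \<le> e * (15 * N + 7) * N"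
          using e N1 by (intro mult_left_mono) auto
        also have "\<dots> = \<epsilon> * R * (2 * G)" using G0 by (simp add: e_def R_def field_simps)
        also have "\<dots> \<le> 1 * (2 * G)" using small(5) G0 by (intro mult_right_mono) auto
        finally have "e * (15 * N + 7) * ?K \<le> 2 * G" by simp
        moreover have "4 * G \<le> f\<^sup>2 * G"
          using power_mono[of 2 f 2] f G0 by (intro mult_right_mono) auto
        ultimately show "e * (15 * N + 7) * ?K - f\<^sup>2 * G \<le> - 2 * G" by linarith
      qed (use \<epsilon> in simp)
      finally show ?thesis by (simp add: algebra_simps)
    qed
    define P where "P = (\<Sum>i<n. LBINT x:{0..len i}. \<bar>u i x\<bar> powr (2 * k + 2)) + (LBINT x:{0..}. \<bar>uh x\<bar> powr (2 * k + 2))"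
    \<comment> \<open>\<open>2187 = 3^7\<close> since \<open>V \<le> 3\<close> and the exponent is
      at most 7; 28 comes from the soliton.\<close>
    have P_le: "P \<le> c\<^sup>2 * (2187 * ?K + 28)"
    proof -
      have "(LBINT x:{0..len i}. \<bar>u i x\<bar> powr (2 * k + 2)) \<le> 2187 * c\<^sup>2 * len i" if i: "i < n" for i
      proof -
        have bound: "\<bar>u i x\<bar> powr (2 * k + 2) \<le> 2187 * c\<^sup>2" if x: "x \<in> {0..len i}" for x
        proof -
          have "V i x powr (2 * k + 2) \<le> 3 powr (2 * k + 2)"
            using V_range[OF i x] k by (intro powr_mono2) auto
          also have "\<dots> \<le> 3 powr 7" using k by (intro powr_mono) auto
          also have "\<dots> = 2187" by (simp add: powr_numeral)
          finally have "\<epsilon>\<^sup>2 * V i x powr (2 * k + 2) \<le> 1 * 2187"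
            using \<epsilon> by (intro mult_mono) (auto simp: power_le_one)
          then have "c\<^sup>2 * (\<epsilon>\<^sup>2 * V i x powr (2 * k + 2)) \<le> c\<^sup>2 * 2187"
            by (intro mult_left_mono) auto
          moreover have "\<bar>u i x\<bar> powr (2 * k + 2) = c\<^sup>2 * (\<epsilon>\<^sup>2 * V i x powr (2 * k + 2))"
            using c V_range[OF i x] by (simp add: uV[OF i x] abs_mult powr_mult powr_c)
          ultimately show ?thesis by simp
        qed
        have "continuous_on {0..len i} (u i)"
          using ode[OF i] by (rule ode_sol_on_continuous)
        then have cp: "continuous_on {0..len i} (\<lambda>x. \<bar>u i x\<bar> powr (2 * k + 2))"
          using u_pos[OF i] by (intro continuous_intros) force+
        show ?thesis
          unfolding LBINT_Icc_eq_integral[OF cp]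
          using integral_bound[OF _ cp, of "2187 * c\<^sup>2"] bound len_pos[OF i] by (simp add: abs_le_iff)
      qed
      then have "(\<Sum>i<n. LBINT x:{0..len i}. \<bar>u i x\<bar> powr (2 * k + 2)) \<le> (\<Sum>i<n. 2187 * c\<^sup>2 * len i)"
        by (intro sum_mono) simp
      then show ?thesis
        using half_line(5) unfolding P_def sum_distrib_left[symmetric] by (simp add: algebra_simps)
    qed
    have P0: "0 \<le> P"
      unfolding P_def set_lebesgue_integral_def by (intro add_nonneg_nonneg sum_nonneg integral_nonneg) auto
    \<comment> \<open>This is \<open>(p - 6) / (4 p)\<close>; with \<open>p \<ge> 6\<close> it is at
      most \<open>(k - 2) / 12\<close>.\<close>
    define \<gamma> where "\<gamma> = (2 * k + 2 - 6) / (4 * (2 * k + 2))"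
    have \<gamma>: "0 \<le> \<gamma>" "\<gamma> \<le> \<eta>"
    proof -
      have "\<gamma> \<le> (2 * k - 4) / 24" unfolding \<gamma>_def using k by (intro frac_le) auto
      then show "\<gamma> \<le> \<eta>" using k\<eta> \<eta> by simp
    qed (use k in \<open>simp add: \<gamma>_def\<close>)
    have "1 / 2 * ((\<Sum>i<n. LBINT x:{0..len i}. (du i x)\<^sup>2) + (LBINT x:{0..}. (duh x)\<^sup>2)) - 1 / (2 * k + 2) * P
      = (\<Sum>i<n. 1 / 2 * (LBINT x:{0..len i}. (du i x)\<^sup>2) - 1 / (2 * k + 2) * (LBINT x:{0..len i}. \<bar>u i x\<bar> powr (2 * k + 2)))
        + (1 / 2 * (LBINT x:{0..}. (duh x)\<^sup>2) - 1 / (2 * k + 2) * (LBINT x:{0..}. \<bar>uh x\<bar> powr (2 * k + 2)))"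
      unfolding P_def sum_subtractf sum_distrib_left[symmetric] by (simp add: algebra_simps add_divide_distrib)
    also have "(\<Sum>i<n. 1 / 2 * (LBINT x:{0..len i}. (du i x)\<^sup>2) - 1 / (2 * k + 2) * (LBINT x:{0..len i}. \<bar>u i x\<bar> powr (2 * k + 2)))
      = (\<Sum>i<n. h i * len i / 2 + (u i (len i) * du i (len i) - u i 0 * du i 0) / 4
           + \<gamma> * (LBINT x:{0..len i}. \<bar>u i x\<bar> powr (2 * k + 2)))"
      unfolding \<gamma>_def using ode u_pos len_pos k0
      by (intro sum.cong refl ode_energy_Icc) (auto simp: h_def less_imp_le)
    also have "\<dots> = (\<Sum>i<n. h i * len i) / 2 + uh 0 * duh 0 / 4
        + \<gamma> * (\<Sum>i<n. LBINT x:{0..len i}. \<bar>u i x\<bar> powr (2 * k + 2))"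
      unfolding boundary[symmetric] by (simp add: sum.distrib sum_divide_distrib sum_distrib_left)
    finally have "1 / 2 * ((\<Sum>i<n. LBINT x:{0..len i}. (du i x)\<^sup>2) + (LBINT x:{0..}. (duh x)\<^sup>2)) - 1 / (2 * k + 2) * P
      = (\<Sum>i<n. h i * len i) / 2 + \<gamma> * P"
      unfolding half_line(6) \<gamma>_def[symmetric] P_def by (simp add: algebra_simps)
    also have "\<dots> \<le> - (c\<^sup>2 * \<epsilon> ^ 4 * G) + \<eta> * (c\<^sup>2 * (2187 * ?K + 28))"
      using sum_h mult_mono[OF \<gamma>(2) P_le] P0 \<eta> by simp
    also have "\<dots> = c\<^sup>2 * (\<eta> * (2187 * ?K + 28) - \<epsilon> ^ 4 * G)" by (simp add: algebra_simps)
    also have "\<dots> < 0" using \<eta>_small c(1) by (intro mult_pos_neg) auto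
    finally have energy: "1 / 2 * ((\<Sum>i<n. LBINT x:{0..len i}. (du i x)\<^sup>2) + (LBINT x:{0..}. (duh x)\<^sup>2))
      - 1 / (2 * k + 2) * P < 0" .
    show "has_negative_energy_solution k"
      unfolding has_negative_energy_solution_def
      by (rule exI[of _ u], rule exI[of _ du], rule exI[of _ uh], rule exI[of _ duh],
          rule exI[of _ "\<epsilon>\<^sup>2"], rule exI[of _ phi])
        (intro conjI allI impI ballI ode half_line(1-4) u_pos ends(1,2) uh0 kirchhoff energy[unfolded P_def]; assumption?)
  qed
qed

text \<open>The flow along a spanning tree is a competitor in Thomson's principle, and it is
  strictly cheaper than \<open>K^3\<close>. The degree condition exempts the root: a single edge may
  end there, because the half-line continues it.\<close>

lemma torsion_gap:
  assumes "0 < n" and deg: "\<And>v. v \<noteq> r \<Longrightarrow> edge_deg src tgt {..<n} v \<noteq> 1"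
  shows "(\<Sum>i<n. len i * ((D (\<lambda>_ _. 1) i)\<^sup>2 / 2 + Y (\<lambda>_ _. 1) (src i))) < total_len ^ 3 / 2"
proof -
  let ?D = "D (\<lambda>_ _. 1)" and ?Y = "Y (\<lambda>_ _. 1)"
  obtain q where q: "\<And>v. v \<noteq> r \<Longrightarrow> flux q (\<lambda>i. len i - q i) v = 0"
    and less: "(\<Sum>i<n. q i ^ 3 + (len i - q i) ^ 3) < total_len ^ 3"
    using unit_flow_cost_le[of "{..<n}" len r src tgt] len_pos reach src_less assms(1) deg by auto
  have flux_one: "flux ?D (\<lambda>i. len i - ?D i) v = 0" if "v \<noteq> r" for v
  proof -
    have "flux ?D (\<lambda>i. len i - ?D i) v = flux ?D (\<lambda>i. src1 (\<lambda>_ _. 1) i (len i) - ?D i) v"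
      unfolding net_flux_def by (intro sum.cong refl) (simp add: src1_const len_pos less_imp_le)
    then show ?thesis using flux_D[OF that] by simp
  qed
  have edge_one: "?Y (tgt i) = ?Y (src i) + ?D i * len i - (len i)\<^sup>2 / 2" if "i < n" for i
    using Y_tgt[OF that, of "\<lambda>_ _. 1"] len_pos[OF that] by (simp add: src2_const less_imp_le)
  have "(\<Sum>i<n. len i * ((?D i)\<^sup>2 / 2 + ?Y (src i))) \<le> (\<Sum>i<n. q i ^ 3 + (len i - q i) ^ 3) / 2"
    by (rule torsion_le_flow_cost[where r = r and tgt = tgt])
      (use q flux_one edge_one len_pos Y_root in auto)
  then show ?thesis using less by linarith
qed

end

lemma (in rooted_graph) exists_negative_energy_solution:
  assumes "0 < n" "\<And>v. v \<noteq> r \<Longrightarrow> edge_deg src tgt {..<n} v \<noteq> 1"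
  shows "\<exists>\<eta>>0. \<forall>k. 2 \<le> k \<longrightarrow> k \<le> 2 + \<eta> \<longrightarrow> has_negative_energy_solution k"
proof -
  obtain Y D C where G: "green_graph src tgt len n nV r Y D C"
    by (rule green_graph_exists)
  show ?thesis
    by (rule green_graph.negative_energy_solution[OF G green_graph.torsion_gap[OF G assms]]) blast+
qed

section \<open>Transfer to the edge-list encoding\<close>

lemma mg_rooted_graph:
  assumes "mg_wf nV E v0" "mg_connected nV E"
  shows "rooted_graph (etail E) (ehead E) (elen E) (length E) nV v0"
proof -
  have wf: "v0 < nV" "\<And>i. i < length E \<Longrightarrow> etail E i < nV \<and> ehead E i < nV \<and> 0 < elen E i"
    using assms(1) nth_mem[of _ E] unfolding mg_wf_def etail_def ehead_def elen_def by fastforce+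
  have adj: "mg_adj E \<subseteq> edge_rel (etail E) (ehead E) {..<length E}"
    unfolding mg_adj_def edge_rel_def etail_def ehead_def
    by (auto simp: in_set_conv_nth) (metis fst_conv lessThan_iff snd_conv)+
  show ?thesis
    using wf assms(2) rtrancl_mono[OF adj] by unfold_locales (auto simp: mg_connected_def)
qed

text \<open>Away from \<open>v0\<close> both notions of degree agree, loops counting twice in each.
  Degree 1 forces an edge at \<open>v\<close>, and that edge would be a pendant.\<close>

lemma mg_no_pendant_edge_deg:
  assumes "mg_no_pendant E v0" and v: "v \<noteq> v0"
  shows "edge_deg (etail E) (ehead E) {..<length E} v \<noteq> 1"
proof
  assume *: "edge_deg (etail E) (ehead E) {..<length E} v = 1"
  have "mg_deg E v0 v = edge_deg (etail E) (ehead E) {..<length E} v"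
    using v unfolding mg_deg_def edge_deg_def length_filter_conv_card etail_def ehead_def
    by (simp add: case_prod_beta)
  with * have deg: "mg_deg E v0 v = 1" by simp
  have "\<exists>i<length E. etail E i = v \<or> ehead E i = v"
  proof (rule ccontr)
    assume "\<not> ?thesis"
    then have "{i \<in> {..<length E}. etail E i = v} = {}" "{i \<in> {..<length E}. ehead E i = v} = {}" by auto
    then have "edge_deg (etail E) (ehead E) {..<length E} v = 0" by (simp only: edge_deg_def card.empty)
    with * show False by simp
  qed
  then obtain i where "i < length E" "etail E i = v \<or> ehead E i = v" by blast
  then show False
    using assms(1) deg nth_mem[of i E] unfolding mg_no_pendant_def etail_def ehead_def
    by (auto simp: case_prod_beta)
qed

text \<open>The stretch \<open>[0, 1]\<close> of the half-line already carries positive mass,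
  because a positive continuous function has a positive minimum there.\<close>

lemma mass_pos:
  assumes ode: "ode_sol_on {0..} p lam uh duh" and pos: "\<forall>x\<ge>0. 0 < uh x"
    and int: "set_integrable lborel {0..} (\<lambda>x. (uh x)\<^sup>2)"
  shows "0 < mass E u uh"
proof -
  have c: "continuous_on {0..1} (\<lambda>x. (uh x)\<^sup>2)"
    by (intro continuous_on_power continuous_on_subset[OF ode_sol_on_continuous[OF ode]]) auto
  then obtain y where y: "y \<in> {0..1}" "\<And>x. x \<in> {0..1} \<Longrightarrow> (uh y)\<^sup>2 \<le> (uh x)\<^sup>2"
    using continuous_attains_inf[of "{0..1::real}" "\<lambda>x. (uh x)\<^sup>2"] by auto
  have "0 < (uh y)\<^sup>2" using pos y(1) by force
  also have "(uh y)\<^sup>2 = integral {0..1} (\<lambda>x::real. (uh y)\<^sup>2)" by simp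
  also have "\<dots> \<le> integral {0..1} (\<lambda>x. (uh x)\<^sup>2)"
    using c y(2) by (intro integral_le integrable_continuous_real) auto
  also have "\<dots> = (LBINT x:{0..1}. (uh x)\<^sup>2)" using LBINT_Icc_eq_integral[OF c] by simp
  also have "\<dots> \<le> (LBINT x:{0..}. (uh x)\<^sup>2)"
    using int set_integrable_subset[OF int, of "{0..1}"]
    unfolding set_lebesgue_integral_def set_integrable_def
    by (intro integral_mono) (auto simp: indicator_def)
  finally have "0 < (LBINT x:{0..}. (uh x)\<^sup>2)" .
  moreover have "0 \<le> (\<Sum>i<length E. LBINT x:{0..elen E i}. (u i x)\<^sup>2)"
    unfolding set_lebesgue_integral_def by (intro sum_nonneg integral_nonneg) auto
  ultimately show ?thesis by (simp add: mass_def)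
qed

theorem theorem1p3:
  fixes nV :: nat and E :: "(nat \<times> nat \<times> real) list" and v0 :: nat
  assumes "mg_wf nV E v0"
    and "mg_connected nV E"
    and "E \<noteq> []"
    and "mg_no_pendant E v0"
  shows "\<exists>\<delta>>0. \<forall>p\<in>{6..6+\<delta>}. \<exists>\<mu>>0. \<exists>u du uh duh (lam::real).
           positive_solution nV E v0 p lam u du uh duh
           \<and> mass E u uh = \<mu> \<and> energy E p u du uh duh < 0"
proof -
  have G: "rooted_graph (etail E) (ehead E) (elen E) (length E) nV v0"
    by (rule mg_rooted_graph) fact+
  have "0 < length E" using assms(3) by simp
  then obtain \<eta> where \<eta>: "0 < \<eta>" and sol: "\<And>k. 2 \<le> k \<Longrightarrow> k \<le> 2 + \<eta> \<Longrightarrow>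
      rooted_graph.has_negative_energy_solution (etail E) (ehead E) (elen E) (length E) v0 k"
    using rooted_graph.exists_negative_energy_solution[OF G _ mg_no_pendant_edge_deg[OF assms(4)]]
    by blast
  show ?thesis
  \<comment> \<open>The factor 2 comes from \<open>p = 2 * k + 2\<close>.\<close>
  proof (rule exI[of _ "2 * \<eta>"], intro conjI ballI)
    show "0 < 2 * \<eta>" using \<eta> by simp
    fix p assume p: "p \<in> {6..6 + 2 * \<eta>}"
    define k where "k = p / 2 - 1"
    have k: "2 \<le> k" "k \<le> 2 + \<eta>" and pk: "2 * k + 2 = p" using p by (auto simp: k_def field_simps)
    obtain u du uh duh lam and phi :: "nat \<Rightarrow> real" where
      s: "\<forall>i<length E. ode_sol_on {0..elen E i} p lam (u i) (du i)" "ode_sol_on {0..} p lam uh duh"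
        "\<forall>i<length E. \<forall>x\<in>{0..elen E i}. 0 < u i x" "\<forall>x\<ge>0. 0 < uh x"
        "\<forall>i<length E. u i 0 = phi (etail E i) \<and> u i (elen E i) = phi (ehead E i)" "uh 0 = phi v0"
        "set_integrable lborel {0..} (\<lambda>x. (uh x)\<^sup>2)" "set_integrable lborel {0..} (\<lambda>x. (duh x)\<^sup>2)"
        "\<forall>v. net_flux (etail E) (ehead E) {..<length E} (\<lambda>i. du i 0) (\<lambda>i. - du i (elen E i)) v + (if v = v0 then duh 0 else 0) = 0"
        "1 / 2 * ((\<Sum>i<length E. LBINT x:{0..elen E i}. (du i x)\<^sup>2) + (LBINT x:{0..}. (duh x)\<^sup>2))
          - 1 / p * ((\<Sum>i<length E. LBINT x:{0..elen E i}. \<bar>u i x\<bar> powr p) + (LBINT x:{0..}. \<bar>uh x\<bar> powr p)) < 0"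
      using sol[OF k] unfolding rooted_graph.has_negative_energy_solution_def[OF G] pk by blast
    have "positive_solution nV E v0 p lam u du uh duh"
      unfolding positive_solution_def using s(1-8) s(9)[unfolded net_flux_def] by auto
    moreover have "energy E p u du uh duh < 0" using s(10) by (simp add: energy_def)
    ultimately show "\<exists>\<mu>>0. \<exists>u du uh duh lam. positive_solution nV E v0 p lam u du uh duh
           \<and> mass E u uh = \<mu> \<and> energy E p u du uh duh < 0"
      using mass_pos[OF s(2,4,7)] by blast
  qed
qed

end
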